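(* Let $\Lambda$ be an Artinian algebra which is local and has radical square zero, i.e. $J(\Lambda)^2=0$. Let $M$ be a finitely generated left $\Lambda$-module which is torsionless. If $\operatorname{Ext}^1_\Lambda(M,M)=0$, then $M$ is projective.
   Context: An Artinian algebra (Artin algebra) is a ring $\Lambda$ whose center $R$ is a commutative Artinian ring and which is finitely generated as an $R$-module. $J(\Lambda)$ denotes the Jacobson radical of $\Lambda$; $\Lambda$ is local if $\Lambda/J(\Lambda)$ is a division ring. All modules are finitely generated. Write $(-)^*=\operatorname{Hom}_\Lambda(-,\Lambda)$. A module $M$ is torsionless if the canonical evaluation homomorphism $\sigma_M:M\to M^{**}$, $\sigma_M(x)(f)=f(x)$ for $x\in M$, $f\in M^*$, is a monomorphism. *)

theory Defs
  imports "HOL-Algebra.Module" "HOL-Algebra.QuotRing" "HOL-Algebra.Ideal_Product"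
    "HOL-Algebra.Elementary_Groups"
begin

section \<open>Left modules over a not necessarily commutative ring\<close>

text \<open>
  The locale \<^locale>\<open>module\<close> of HOL-Algebra requires commutative scalars. We keep its
  record type but drop that requirement; the fields \<open>mult\<close> and \<open>one\<close> of the
  record carry no meaning for modules.
\<close>

locale left_module = R?: ring R + M?: abelian_group M
  for R :: "('r, 'e) ring_scheme" (structure) and M :: "('r, 'm) module" (structure) +
  assumes smult_closed [simp, intro]:
      "\<lbrakk>a \<in> carrier R; x \<in> carrier M\<rbrakk> \<Longrightarrow> a \<odot>\<^bsub>M\<^esub> x \<in> carrier M"
    and smult_l_distr:
      "\<lbrakk>a \<in> carrier R; b \<in> carrier R; x \<in> carrier M\<rbrakk> \<Longrightarrow>
        (a \<oplus>\<^bsub>R\<^esub> b) \<odot>\<^bsub>M\<^esub> x = a \<odot>\<^bsub>M\<^esub> x \<oplus>\<^bsub>M\<^esub> b \<odot>\<^bsub>M\<^esub> x"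
    and smult_r_distr:
      "\<lbrakk>a \<in> carrier R; x \<in> carrier M; y \<in> carrier M\<rbrakk> \<Longrightarrow>
        a \<odot>\<^bsub>M\<^esub> (x \<oplus>\<^bsub>M\<^esub> y) = a \<odot>\<^bsub>M\<^esub> x \<oplus>\<^bsub>M\<^esub> a \<odot>\<^bsub>M\<^esub> y"
    and smult_assoc:
      "\<lbrakk>a \<in> carrier R; b \<in> carrier R; x \<in> carrier M\<rbrakk> \<Longrightarrow>
        (a \<otimes>\<^bsub>R\<^esub> b) \<odot>\<^bsub>M\<^esub> x = a \<odot>\<^bsub>M\<^esub> (b \<odot>\<^bsub>M\<^esub> x)"
    and smult_one [simp]:
      "x \<in> carrier M \<Longrightarrow> \<one>\<^bsub>R\<^esub> \<odot>\<^bsub>M\<^esub> x = x"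

definition regular_module :: "('r, 'e) ring_scheme \<Rightarrow> ('r, 'r) module" where
  "regular_module R =
    \<lparr>carrier = carrier R, mult = mult R, one = one R, zero = zero R, add = add R,
     smult = mult R\<rparr>"

definition fin_gen_module :: "('r, 'e) ring_scheme \<Rightarrow> ('r, 'm) module \<Rightarrow> bool" where
  "fin_gen_module R M \<longleftrightarrow>
    (\<exists>S. finite S \<and> S \<subseteq> carrier M \<and>
      (\<forall>x \<in> carrier M. \<exists>c \<in> S \<rightarrow> carrier R. x = (\<Oplus>\<^bsub>M\<^esub>s\<in>S. c s \<odot>\<^bsub>M\<^esub> s)))"

text \<open>Homomorphisms are extensional functions, so that equality of homomorphisms is equality.\<close>

definition module_hom ::
    "('r, 'e) ring_scheme \<Rightarrow> ('r, 'm) module \<Rightarrow> ('r, 'n) module \<Rightarrow> ('m \<Rightarrow> 'n) set" where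
  "module_hom R M N =
    {f \<in> carrier M \<rightarrow>\<^sub>E carrier N.
      (\<forall>x \<in> carrier M. \<forall>y \<in> carrier M. f (x \<oplus>\<^bsub>M\<^esub> y) = f x \<oplus>\<^bsub>N\<^esub> f y) \<and>
      (\<forall>r \<in> carrier R. \<forall>x \<in> carrier M. f (r \<odot>\<^bsub>M\<^esub> x) = r \<odot>\<^bsub>N\<^esub> f x)}"

text \<open>
  Projectivity is the lifting property against all surjections \<open>g : A \<rightarrow> B\<close> whose modules
  have elements in the types \<open>'a\<close> and \<open>'b\<close>. Since a definition cannot quantify over types,
  these are parameters; a theorem concluding projectivity for two free type variables asserts
  the lifting property against all surjections.
\<close>

definition projective_module ::
    "'a itself \<Rightarrow> 'b itself \<Rightarrow> ('r, 'e) ring_scheme \<Rightarrow> ('r, 'm) module \<Rightarrow> bool" where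
  "projective_module TA TB R P \<longleftrightarrow>
    left_module R P \<and>
    (\<forall>(A :: ('r, 'a) module) (B :: ('r, 'b) module). \<forall>g \<in> module_hom R A B.
       left_module R A \<longrightarrow> left_module R B \<longrightarrow> g ` carrier A = carrier B \<longrightarrow>
       (\<forall>f \<in> module_hom R P B. \<exists>h \<in> module_hom R P A. \<forall>x \<in> carrier P. g (h x) = f x))"


section \<open>Artin algebras, Jacobson radical, local rings\<close>

definition ring_center :: "('r, 'e) ring_scheme \<Rightarrow> 'r set" where
  "ring_center R = {z \<in> carrier R. \<forall>x \<in> carrier R. z \<otimes>\<^bsub>R\<^esub> x = x \<otimes>\<^bsub>R\<^esub> z}"

definition center_ring :: "('r, 'e) ring_scheme \<Rightarrow> ('r, 'e) ring_scheme" where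
  "center_ring R = R\<lparr>carrier := ring_center R\<rparr>"

definition comm_artinian_ring :: "('r, 'e) ring_scheme \<Rightarrow> bool" where
  "comm_artinian_ring R \<longleftrightarrow>
    cring R \<and>
    (\<forall>I :: nat \<Rightarrow> 'r set. (\<forall>n. ideal (I n) R) \<and> (\<forall>n. I (Suc n) \<subseteq> I n) \<longrightarrow>
      (\<exists>N. \<forall>n \<ge> N. I n = I N))"

definition artin_algebra :: "('r, 'e) ring_scheme \<Rightarrow> bool" where
  "artin_algebra R \<longleftrightarrow>
    ring R \<and> comm_artinian_ring (center_ring R) \<and>
    fin_gen_module (center_ring R) (regular_module R)"

definition left_ideal :: "'r set \<Rightarrow> ('r, 'e) ring_scheme \<Rightarrow> bool" where
  "left_ideal I R \<longleftrightarrow>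
    additive_subgroup I R \<and> (\<forall>r \<in> carrier R. \<forall>x \<in> I. r \<otimes>\<^bsub>R\<^esub> x \<in> I)"

definition maximal_left_ideal :: "'r set \<Rightarrow> ('r, 'e) ring_scheme \<Rightarrow> bool" where
  "maximal_left_ideal I R \<longleftrightarrow>
    left_ideal I R \<and> I \<noteq> carrier R \<and>
    (\<forall>K. left_ideal K R \<and> I \<subseteq> K \<longrightarrow> K = I \<or> K = carrier R)"

definition jacobson_radical :: "('r, 'e) ring_scheme \<Rightarrow> 'r set" where
  "jacobson_radical R = {x \<in> carrier R. \<forall>I. maximal_left_ideal I R \<longrightarrow> x \<in> I}"

text \<open>The equation on units excludes the zero ring, whose zero is a unit.\<close>

definition division_ring :: "('r, 'e) ring_scheme \<Rightarrow> bool" where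
  "division_ring R \<longleftrightarrow> ring R \<and> Units R = carrier R - {\<zero>\<^bsub>R\<^esub>}"

definition local_ring :: "('r, 'e) ring_scheme \<Rightarrow> bool" where
  "local_ring R \<longleftrightarrow> ring R \<and> division_ring (R Quot jacobson_radical R)"


section \<open>Duals and torsionless modules\<close>

text \<open>
  The dual of a left \<open>R\<close>-module is a right \<open>R\<close>-module via \<open>(f r)(x) = f(x) r\<close>. Right
  \<open>R\<close>-modules are represented as left modules over the opposite ring. The opposite of the
  opposite ring is \<open>R\<close> itself, so the bidual is again a left \<open>R\<close>-module, with
  \<open>(r \<phi>)(f) = r \<phi>(f)\<close>.
\<close>

definition opposite_ring :: "('r, 'e) ring_scheme \<Rightarrow> ('r, 'e) ring_scheme" where
  "opposite_ring R = R\<lparr>mult := (\<lambda>x y. y \<otimes>\<^bsub>R\<^esub> x)\<rparr>"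

definition dual_module ::
    "('r, 'e) ring_scheme \<Rightarrow> ('r, 'm) module \<Rightarrow> ('r, 'm \<Rightarrow> 'r) module" where
  "dual_module R M =
    \<lparr>carrier = module_hom R M (regular_module R), mult = undefined, one = undefined,
     zero = (\<lambda>x \<in> carrier M. \<zero>\<^bsub>R\<^esub>),
     add = (\<lambda>f g. \<lambda>x \<in> carrier M. f x \<oplus>\<^bsub>R\<^esub> g x),
     smult = (\<lambda>r f. \<lambda>x \<in> carrier M. f x \<otimes>\<^bsub>R\<^esub> r)\<rparr>"

definition bidual_module ::
    "('r, 'e) ring_scheme \<Rightarrow> ('r, 'm) module \<Rightarrow> ('r, ('m \<Rightarrow> 'r) \<Rightarrow> 'r) module" where
  "bidual_module R M = dual_module (opposite_ring R) (dual_module R M)"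

definition evaluation_map ::
    "('r, 'e) ring_scheme \<Rightarrow> ('r, 'm) module \<Rightarrow> 'm \<Rightarrow> ('m \<Rightarrow> 'r) \<Rightarrow> 'r" where
  "evaluation_map R M = (\<lambda>x \<in> carrier M. \<lambda>f \<in> carrier (dual_module R M). f x)"

definition torsionless :: "('r, 'e) ring_scheme \<Rightarrow> ('r, 'm) module \<Rightarrow> bool" where
  "torsionless R M \<longleftrightarrow>
    evaluation_map R M \<in> module_hom R M (bidual_module R M) \<and>
    inj_on (evaluation_map R M) (carrier M)"


section \<open>The first extension group\<close>

text \<open>The free module on \<open>X\<close>: finitely supported functions, extended by zero outside \<open>X\<close>.\<close>

definition free_module :: "('r, 'e) ring_scheme \<Rightarrow> 'x set \<Rightarrow> ('r, 'x \<Rightarrow> 'r) module" where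
  "free_module R X =
    \<lparr>carrier = {c. range c \<subseteq> carrier R \<and> finite {x. c x \<noteq> \<zero>\<^bsub>R\<^esub>} \<and> {x. c x \<noteq> \<zero>\<^bsub>R\<^esub>} \<subseteq> X},
     mult = undefined, one = undefined,
     zero = (\<lambda>x. \<zero>\<^bsub>R\<^esub>),
     add = (\<lambda>c d x. c x \<oplus>\<^bsub>R\<^esub> d x),
     smult = (\<lambda>r c x. r \<otimes>\<^bsub>R\<^esub> c x)\<rparr>"

definition linear_combination ::
    "('r, 'e) ring_scheme \<Rightarrow> ('r, 'm) module \<Rightarrow> ('m \<Rightarrow> 'r) \<Rightarrow> 'm" where
  "linear_combination R M c = (\<Oplus>\<^bsub>M\<^esub>x\<in>{x. c x \<noteq> \<zero>\<^bsub>R\<^esub>}. c x \<odot>\<^bsub>M\<^esub> x)"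

text \<open>
  The canonical free resolution
  \<open>\<dots> \<rightarrow> P\<^sub>2 \<rightarrow> P\<^sub>1 \<rightarrow> P\<^sub>0 \<rightarrow> M \<rightarrow> 0\<close>: each term is the free module on the set of elements of the
  preceding kernel (of \<open>M\<close> itself for \<open>P\<^sub>0\<close>), and each map sends a formal linear combination
  to its value.
\<close>

definition res_P0 :: "('r, 'e) ring_scheme \<Rightarrow> ('r, 'm) module \<Rightarrow> ('r, 'm \<Rightarrow> 'r) module" where
  "res_P0 R M = free_module R (carrier M)"

definition res_P1 ::
    "('r, 'e) ring_scheme \<Rightarrow> ('r, 'm) module \<Rightarrow> ('r, ('m \<Rightarrow> 'r) \<Rightarrow> 'r) module" where
  "res_P1 R M =
    free_module R {p \<in> carrier (res_P0 R M). linear_combination R M p = \<zero>\<^bsub>M\<^esub>}"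

definition res_d1 ::
    "('r, 'e) ring_scheme \<Rightarrow> ('r, 'm) module \<Rightarrow> (('m \<Rightarrow> 'r) \<Rightarrow> 'r) \<Rightarrow> 'm \<Rightarrow> 'r" where
  "res_d1 R M = linear_combination R (res_P0 R M)"

definition res_P2 ::
    "('r, 'e) ring_scheme \<Rightarrow> ('r, 'm) module \<Rightarrow> ('r, (('m \<Rightarrow> 'r) \<Rightarrow> 'r) \<Rightarrow> 'r) module" where
  "res_P2 R M =
    free_module R {p \<in> carrier (res_P1 R M). res_d1 R M p = \<zero>\<^bsub>res_P0 R M\<^esub>}"

definition res_d2 ::
    "('r, 'e) ring_scheme \<Rightarrow> ('r, 'm) module \<Rightarrow>
      ((('m \<Rightarrow> 'r) \<Rightarrow> 'r) \<Rightarrow> 'r) \<Rightarrow> ('m \<Rightarrow> 'r) \<Rightarrow> 'r" where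
  "res_d2 R M = linear_combination R (res_P1 R M)"

definition hom_group ::
    "('r, 'e) ring_scheme \<Rightarrow> ('r, 'm) module \<Rightarrow> ('r, 'n) module \<Rightarrow> ('m \<Rightarrow> 'n) monoid" where
  "hom_group R M N =
    \<lparr>carrier = module_hom R M N,
     mult = (\<lambda>f g. \<lambda>x \<in> carrier M. f x \<oplus>\<^bsub>N\<^esub> g x),
     one = (\<lambda>x \<in> carrier M. \<zero>\<^bsub>N\<^esub>)\<rparr>"

definition precomp :: "('r, 'l) module \<Rightarrow> ('l \<Rightarrow> 'm) \<Rightarrow> ('m \<Rightarrow> 'n) \<Rightarrow> 'l \<Rightarrow> 'n" where
  "precomp L d f = (\<lambda>x \<in> carrier L. f (d x))"

text \<open>
  \<open>Ext\<^sup>1(M, N)\<close> is the cohomology at \<open>Hom(P\<^sub>1, N)\<close> of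
  \<open>Hom(P\<^sub>0, N) \<rightarrow> Hom(P\<^sub>1, N) \<rightarrow> Hom(P\<^sub>2, N)\<close>.
\<close>

definition Ext1 ::
    "('r, 'e) ring_scheme \<Rightarrow> ('r, 'm) module \<Rightarrow> ('r, 'n) module \<Rightarrow>
      ((('m \<Rightarrow> 'r) \<Rightarrow> 'r) \<Rightarrow> 'n) set monoid" where
  "Ext1 R M N =
    (hom_group R (res_P1 R M) N)
      \<lparr>carrier := kernel (hom_group R (res_P1 R M) N) (hom_group R (res_P2 R M) N)
                    (precomp (res_P2 R M) (res_d2 R M))\<rparr>
    Mod (precomp (res_P1 R M) (res_d1 R M) ` carrier (hom_group R (res_P0 R M) N))"

end

theory Submission
  imports Defs
begin

text \<open>
  Write \<open>J\<close> for the radical. Splitting off free summands leaves a summand \<open>p M\<close> on which every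
  functional takes values in \<open>J\<close>; as \<open>J\<^sup>2 = 0\<close> and \<open>M\<close> is torsionless, \<open>J\<close> annihilates \<open>p M\<close>. If
  \<open>J = 0\<close>, then all functionals vanish on \<open>p M\<close>, so \<open>p M = 0\<close>. If \<open>J \<noteq> 0\<close> and \<open>p M \<noteq> 0\<close>, then the
  simple module is a summand of \<open>M\<close>, and it has a non-split self-extension that is a quotient of
  the algebra, contradicting \<open>Ext\<^sup>1(M, M) = 0\<close>. The argument is carried out on elements of the
  canonical resolution, so the semisimple module \<open>p M\<close> never has to be decomposed.
\<close>

section \<open>Submodules and linear maps\<close>

text \<open>The self-extension comes from \<open>0 -> J -> R -> R/J -> 0\<close>. A nonzero
  \<open>j\<close> in \<open>J\<close> admits a linear map \<open>\<eta>\<close> from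
  \<open>J\<close> to the simple module \<open>R m\<close> with \<open>\<eta> j = m\<close>, and the
  pushout along \<open>\<eta>\<close> is \<open>R\<close> modulo the kernel of
  \<open>\<eta>\<close>. Pulled back along a projection of \<open>M\<close> onto \<open>R m\<close>
  and pushed out along the inclusion of \<open>R m\<close>, it gives a class in Ext^1(M, M); on the
  resolution this class is the map \<open>\<eta> o L\<close> on relations, where \<open>L\<close>
  lifts the projection to coefficients. The projection and \<open>\<eta>\<close> are two instances
  of one extension statement for modules killed by \<open>J\<close>, which are vector spaces over
  \<open>R/J\<close>. A coefficient there is known only modulo \<open>J\<close>; this is harmless
  because \<open>J\<close> kills the element that it multiplies. Projectivity is a lifting property,
  so the complement of \<open>p M\<close> is never built as a free module. It suffices to record
  that every map composed with \<open>1 - p\<close> lifts along surjections, a property to which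
  each split copy of \<open>R\<close> contributes one summand.\<close>

context left_module
begin

lemma smult_zero_left [simp]:
  assumes "x \<in> carrier M"
  shows "\<zero>\<^bsub>R\<^esub> \<odot>\<^bsub>M\<^esub> x = \<zero>\<^bsub>M\<^esub>"
proof -
  have "\<zero>\<^bsub>R\<^esub> \<odot>\<^bsub>M\<^esub> x \<oplus>\<^bsub>M\<^esub> \<zero>\<^bsub>R\<^esub> \<odot>\<^bsub>M\<^esub> x = \<zero>\<^bsub>R\<^esub> \<odot>\<^bsub>M\<^esub> x"
    using assms smult_l_distr[of "\<zero>\<^bsub>R\<^esub>" "\<zero>\<^bsub>R\<^esub>" x] by simp
  then show ?thesis using assms by (simp add: M.add.l_cancel_one)
qed

lemma smult_zero_right [simp]:
  assumes "a \<in> carrier R"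
  shows "a \<odot>\<^bsub>M\<^esub> \<zero>\<^bsub>M\<^esub> = \<zero>\<^bsub>M\<^esub>"
proof -
  have "a \<odot>\<^bsub>M\<^esub> \<zero>\<^bsub>M\<^esub> \<oplus>\<^bsub>M\<^esub> a \<odot>\<^bsub>M\<^esub> \<zero>\<^bsub>M\<^esub> = a \<odot>\<^bsub>M\<^esub> \<zero>\<^bsub>M\<^esub>"
    using assms smult_r_distr[of a "\<zero>\<^bsub>M\<^esub>" "\<zero>\<^bsub>M\<^esub>"] by simp
  then show ?thesis using assms by (simp add: M.add.l_cancel_one)
qed

lemma smult_minus_left:
  assumes "a \<in> carrier R" "x \<in> carrier M"
  shows "(\<ominus>\<^bsub>R\<^esub> a) \<odot>\<^bsub>M\<^esub> x = \<ominus>\<^bsub>M\<^esub> (a \<odot>\<^bsub>M\<^esub> x)"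
proof -
  have "(\<ominus>\<^bsub>R\<^esub> a) \<odot>\<^bsub>M\<^esub> x \<oplus>\<^bsub>M\<^esub> a \<odot>\<^bsub>M\<^esub> x = \<zero>\<^bsub>M\<^esub>"
    using assms smult_l_distr[of "\<ominus>\<^bsub>R\<^esub> a" a x] by (simp add: R.l_neg)
  then show ?thesis using assms by (simp add: M.minus_equality)
qed

lemma smult_minus_right:
  assumes "a \<in> carrier R" "x \<in> carrier M"
  shows "a \<odot>\<^bsub>M\<^esub> (\<ominus>\<^bsub>M\<^esub> x) = \<ominus>\<^bsub>M\<^esub> (a \<odot>\<^bsub>M\<^esub> x)"
proof -
  have "a \<odot>\<^bsub>M\<^esub> (\<ominus>\<^bsub>M\<^esub> x) \<oplus>\<^bsub>M\<^esub> a \<odot>\<^bsub>M\<^esub> x = \<zero>\<^bsub>M\<^esub>"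
    using assms smult_r_distr[of a "\<ominus>\<^bsub>M\<^esub> x" x] by (simp add: M.l_neg)
  then show ?thesis using assms by (simp add: M.minus_equality)
qed

text \<open>Closure under negation comes from scaling by -1. The predicate \<open>submodule\<close>
  only asks for an additive subgroup closed under scalars, so it makes sense over non-commutative
  rings.\<close>

lemma submoduleI:
  assumes "N \<subseteq> carrier M" "\<zero>\<^bsub>M\<^esub> \<in> N"
    and "\<And>x y. x \<in> N \<Longrightarrow> y \<in> N \<Longrightarrow> x \<oplus>\<^bsub>M\<^esub> y \<in> N"
    and smult: "\<And>a x. a \<in> carrier R \<Longrightarrow> x \<in> N \<Longrightarrow> a \<odot>\<^bsub>M\<^esub> x \<in> N"
  shows "submodule N R M"
proof (intro submodule.intro subgroup.intro submodule_axioms.intro)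
  fix x assume "x \<in> N"
  then have "(\<ominus>\<^bsub>R\<^esub> \<one>\<^bsub>R\<^esub>) \<odot>\<^bsub>M\<^esub> x = \<ominus>\<^bsub>M\<^esub> x"
    using assms(1) by (auto simp: smult_minus_left)
  then show "inv\<^bsub>add_monoid M\<^esub> x \<in> N"
    using smult[of "\<ominus>\<^bsub>R\<^esub> \<one>\<^bsub>R\<^esub>" x] \<open>x \<in> N\<close> by (simp add: a_inv_def)
qed (use assms in auto)

lemma submoduleD:
  assumes "submodule N R M"
  shows "N \<subseteq> carrier M" "\<zero>\<^bsub>M\<^esub> \<in> N"
    and "\<And>x y. x \<in> N \<Longrightarrow> y \<in> N \<Longrightarrow> x \<oplus>\<^bsub>M\<^esub> y \<in> N"
    and "\<And>x. x \<in> N \<Longrightarrow> \<ominus>\<^bsub>M\<^esub> x \<in> N"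
    and "\<And>a x. a \<in> carrier R \<Longrightarrow> x \<in> N \<Longrightarrow> a \<odot>\<^bsub>M\<^esub> x \<in> N"
proof -
  interpret N: submodule N R M by fact
  show "N \<subseteq> carrier M" "\<zero>\<^bsub>M\<^esub> \<in> N"
    using N.subset N.one_closed by auto
  show "\<And>x y. x \<in> N \<Longrightarrow> y \<in> N \<Longrightarrow> x \<oplus>\<^bsub>M\<^esub> y \<in> N"
    using N.m_closed by auto
  show "\<And>x. x \<in> N \<Longrightarrow> \<ominus>\<^bsub>M\<^esub> x \<in> N"
    using N.m_inv_closed by (auto simp: a_inv_def)
  show "\<And>a x. a \<in> carrier R \<Longrightarrow> x \<in> N \<Longrightarrow> a \<odot>\<^bsub>M\<^esub> x \<in> N"
    by (rule N.smult_closed)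
qed

lemma submodule_carrier: "submodule (carrier M) R M"
  by (rule submoduleI) auto

lemma submodule_zero: "submodule {\<zero>\<^bsub>M\<^esub>} R M"
  by (rule submoduleI) auto

lemma finsum_mem_submodule:
  assumes "submodule N R M" "finite S" "g \<in> S \<rightarrow> N"
  shows "finsum M g S \<in> N"
  using assms(2,3)
proof (induction S rule: finite_induct)
  case empty
  then show ?case using submoduleD[OF assms(1)] by simp
next
  case (insert x S)
  then have "g \<in> S \<rightarrow> carrier M" "g x \<in> carrier M"
    using submoduleD(1)[OF assms(1)] by auto
  then show ?case using insert submoduleD(3)[OF assms(1)] by auto
qed

end

section \<open>The regular module and free modules as left modules\<close>

lemma left_module_regular:
  assumes "ring R"
  shows "left_module R (regular_module R)"
proof -
  interpret R: ring R by fact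
  have "abelian_group (regular_module R)"
  proof (rule abelian_groupI)
    show "x \<oplus>\<^bsub>regular_module R\<^esub> y = y \<oplus>\<^bsub>regular_module R\<^esub> x"
      if "x \<in> carrier (regular_module R)" "y \<in> carrier (regular_module R)" for x y
      using that by (simp add: regular_module_def R.add.m_comm)
  qed (auto simp: regular_module_def R.add.m_assoc intro: R.add.l_inv_ex)
  then show ?thesis
    by (intro left_module.intro left_module_axioms.intro)
      (auto simp: regular_module_def assms R.l_distr R.r_distr R.m_assoc)
qed

lemma left_module_free:
  assumes "ring R"
  shows "left_module R (free_module R X)"
proof -
  interpret R: ring R by fact
  have add: "c \<in> carrier (free_module R X) \<Longrightarrow> d \<in> carrier (free_module R X) \<Longrightarrow>
      (\<lambda>x. c x \<oplus>\<^bsub>R\<^esub> d x) \<in> carrier (free_module R X)" for c d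
  proof -
    assume cd: "c \<in> carrier (free_module R X)" "d \<in> carrier (free_module R X)"
    have sub: "{x. c x \<oplus>\<^bsub>R\<^esub> d x \<noteq> \<zero>\<^bsub>R\<^esub>} \<subseteq> {x. c x \<noteq> \<zero>\<^bsub>R\<^esub>} \<union> {x. d x \<noteq> \<zero>\<^bsub>R\<^esub>}"
      by auto
    have "finite {x. c x \<oplus>\<^bsub>R\<^esub> d x \<noteq> \<zero>\<^bsub>R\<^esub>}"
      using cd by (intro finite_subset[OF sub]) (auto simp: free_module_def)
    then show ?thesis using cd sub
      by (auto simp: free_module_def image_subset_iff)
  qed
  have smult: "r \<in> carrier R \<Longrightarrow> c \<in> carrier (free_module R X) \<Longrightarrow>
      (\<lambda>x. r \<otimes>\<^bsub>R\<^esub> c x) \<in> carrier (free_module R X)" for r c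
  proof -
    assume rc: "r \<in> carrier R" "c \<in> carrier (free_module R X)"
    have sub: "{x. r \<otimes>\<^bsub>R\<^esub> c x \<noteq> \<zero>\<^bsub>R\<^esub>} \<subseteq> {x. c x \<noteq> \<zero>\<^bsub>R\<^esub>}"
      using rc(1) by auto
    have "finite {x. r \<otimes>\<^bsub>R\<^esub> c x \<noteq> \<zero>\<^bsub>R\<^esub>}"
      using rc by (intro finite_subset[OF sub]) (auto simp: free_module_def)
    then show ?thesis using rc sub
      by (auto simp: free_module_def image_subset_iff)
  qed
  have neg: "\<exists>d\<in>carrier (free_module R X). (\<lambda>x. d x \<oplus>\<^bsub>R\<^esub> c x) = (\<lambda>x. \<zero>\<^bsub>R\<^esub>)"
    if c: "c \<in> carrier (free_module R X)" for c
  proof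
    have "c x \<in> carrier R" for x
      using c by (auto simp: free_module_def)
    then show "(\<lambda>x. (\<ominus>\<^bsub>R\<^esub> \<one>\<^bsub>R\<^esub>) \<otimes>\<^bsub>R\<^esub> c x \<oplus>\<^bsub>R\<^esub> c x) = (\<lambda>x. \<zero>\<^bsub>R\<^esub>)"
      by (simp add: R.l_minus R.l_neg)
    show "(\<lambda>x. (\<ominus>\<^bsub>R\<^esub> \<one>\<^bsub>R\<^esub>) \<otimes>\<^bsub>R\<^esub> c x) \<in> carrier (free_module R X)"
      using smult c by simp
  qed
  have val: "c x \<in> carrier R" if "c \<in> carrier (free_module R X)" for c x
    using that by (auto simp: free_module_def)
  have ops: "add (free_module R X) = (\<lambda>c d x. c x \<oplus>\<^bsub>R\<^esub> d x)"
    "zero (free_module R X) = (\<lambda>x. \<zero>\<^bsub>R\<^esub>)"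
    "smult (free_module R X) = (\<lambda>r c x. r \<otimes>\<^bsub>R\<^esub> c x)"
    by (auto simp: free_module_def)
  have zero: "(\<lambda>x. \<zero>\<^bsub>R\<^esub>) \<in> carrier (free_module R X)"
    by (auto simp: free_module_def)
  have "abelian_group (free_module R X)"
  proof (rule abelian_groupI)
    show "\<And>c. c \<in> carrier (free_module R X) \<Longrightarrow>
        \<exists>d\<in>carrier (free_module R X). d \<oplus>\<^bsub>free_module R X\<^esub> c = \<zero>\<^bsub>free_module R X\<^esub>"
      using neg by (simp add: ops)
    show "c \<oplus>\<^bsub>free_module R X\<^esub> d = d \<oplus>\<^bsub>free_module R X\<^esub> c"
      if "c \<in> carrier (free_module R X)" "d \<in> carrier (free_module R X)" for c d
      using val[OF that(1)] val[OF that(2)] by (simp add: ops R.add.m_comm)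
  qed (auto simp: ops add zero val R.add.m_assoc)
  then show ?thesis
    by (intro left_module.intro left_module_axioms.intro)
      (auto simp: ops assms smult val R.l_distr R.r_distr R.m_assoc)
qed

text \<open>Linearity is relative to a subset, so that maps defined only on the radical, on a module
  of relations or on the image of a projection need no module record of their own. Values outside
  \<open>V\<close> are unconstrained, so plain lambda terms can be composed without
  \<open>restrict\<close>.\<close>

definition linear_on ::
    "('r, 'e) ring_scheme \<Rightarrow> ('r, 'm) module \<Rightarrow> 'm set \<Rightarrow> ('r, 'n) module \<Rightarrow> ('m \<Rightarrow> 'n) \<Rightarrow> bool" where
  "linear_on R A V B f \<longleftrightarrow>
    f \<in> V \<rightarrow> carrier B \<and>
    (\<forall>x \<in> V. \<forall>y \<in> V. f (x \<oplus>\<^bsub>A\<^esub> y) = f x \<oplus>\<^bsub>B\<^esub> f y) \<and>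
    (\<forall>r \<in> carrier R. \<forall>x \<in> V. f (r \<odot>\<^bsub>A\<^esub> x) = r \<odot>\<^bsub>B\<^esub> f x)"

lemma linear_onI:
  assumes "\<And>x. x \<in> V \<Longrightarrow> f x \<in> carrier B"
    and "\<And>x y. x \<in> V \<Longrightarrow> y \<in> V \<Longrightarrow> f (x \<oplus>\<^bsub>A\<^esub> y) = f x \<oplus>\<^bsub>B\<^esub> f y"
    and "\<And>r x. r \<in> carrier R \<Longrightarrow> x \<in> V \<Longrightarrow> f (r \<odot>\<^bsub>A\<^esub> x) = r \<odot>\<^bsub>B\<^esub> f x"
  shows "linear_on R A V B f"
  using assms by (auto simp: linear_on_def)

lemma linear_onD:
  assumes "linear_on R A V B f"
  shows "\<And>x. x \<in> V \<Longrightarrow> f x \<in> carrier B"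
    and "\<And>x y. x \<in> V \<Longrightarrow> y \<in> V \<Longrightarrow> f (x \<oplus>\<^bsub>A\<^esub> y) = f x \<oplus>\<^bsub>B\<^esub> f y"
    and "\<And>r x. r \<in> carrier R \<Longrightarrow> x \<in> V \<Longrightarrow> f (r \<odot>\<^bsub>A\<^esub> x) = r \<odot>\<^bsub>B\<^esub> f x"
  using assms by (auto simp: linear_on_def)

lemma module_hom_imp_linear_on: "f \<in> module_hom R A B \<Longrightarrow> linear_on R A (carrier A) B f"
  by (auto simp: module_hom_def linear_on_def)

lemma restrict_linear_on:
  assumes "left_module R A" "linear_on R A (carrier A) B f"
  shows "restrict f (carrier A) \<in> module_hom R A B"
proof -
  interpret A: left_module R A by fact
  show ?thesis using assms(2) by (auto simp: module_hom_def linear_on_def)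
qed

lemma linear_on_zero:
  assumes "left_module R A" "left_module R B" "submodule V R A" "linear_on R A V B f"
  shows "f \<zero>\<^bsub>A\<^esub> = \<zero>\<^bsub>B\<^esub>"
proof -
  interpret A: left_module R A by fact
  interpret B: left_module R B by fact
  have "\<zero>\<^bsub>A\<^esub> \<in> V" using A.submoduleD[OF assms(3)] by simp
  then have "f \<zero>\<^bsub>A\<^esub> = f \<zero>\<^bsub>A\<^esub> \<oplus>\<^bsub>B\<^esub> f \<zero>\<^bsub>A\<^esub>" "f \<zero>\<^bsub>A\<^esub> \<in> carrier B"
    using linear_onD[OF assms(4)] by (metis A.M.add.one_closed A.M.l_zero, auto)
  then show ?thesis by (metis B.M.add.l_cancel_one)
qed

lemma linear_on_subset: "linear_on R A V B f \<Longrightarrow> W \<subseteq> V \<Longrightarrow> linear_on R A W B f"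
  by (auto simp: linear_on_def subset_iff)

lemma linear_on_comp:
  assumes "linear_on R A V B f" "linear_on R B W C g" "\<And>x. x \<in> V \<Longrightarrow> f x \<in> W"
  shows "linear_on R A V C (\<lambda>x. g (f x))"
  using assms by (auto simp: linear_on_def)

text \<open>With \<open>N\<close> zero these are kernels, such as the relations in the resolution;
  with \<open>N\<close> the radical, the elements on which a functional takes non-unit
  values.\<close>

lemma submodule_vimage:
  assumes "left_module R A" "left_module R B" "submodule V R A" "linear_on R A V B f"
    and "submodule N R B"
  shows "submodule {x \<in> V. f x \<in> N} R A"
proof -
  interpret A: left_module R A by fact
  interpret B: left_module R B by fact
  show ?thesis
    using A.submoduleD[OF assms(3)] B.submoduleD[OF assms(5)] linear_onD[OF assms(4)]
      linear_on_zero[OF assms(1-4)]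
    by (intro A.submoduleI) auto
qed

section \<open>Weighted sums over free modules\<close>

text \<open>The universal property of the free module: this is the linear map that sends the basis
  vector at \<open>x\<close> to \<open>w x\<close>. Arbitrary weights are allowed because
  functionals on the resolution are needed besides \<open>linear_combination\<close>.\<close>

definition weighted_sum ::
    "('r, 'e) ring_scheme \<Rightarrow> ('r, 'm) module \<Rightarrow> ('x \<Rightarrow> 'm) \<Rightarrow> ('x \<Rightarrow> 'r) \<Rightarrow> 'm" where
  "weighted_sum R M w c = (\<Oplus>\<^bsub>M\<^esub>x\<in>{x. c x \<noteq> \<zero>\<^bsub>R\<^esub>}. c x \<odot>\<^bsub>M\<^esub> w x)"

lemma linear_combination_eq_weighted_sum:
  "linear_combination R M = weighted_sum R M (\<lambda>x. x)"
  by (simp add: fun_eq_iff linear_combination_def weighted_sum_def)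

lemma free_module_simps [simp]:
  "c \<oplus>\<^bsub>free_module R X\<^esub> d = (\<lambda>x. c x \<oplus>\<^bsub>R\<^esub> d x)"
  "\<zero>\<^bsub>free_module R X\<^esub> = (\<lambda>x. \<zero>\<^bsub>R\<^esub>)"
  "r \<odot>\<^bsub>free_module R X\<^esub> c = (\<lambda>x. r \<otimes>\<^bsub>R\<^esub> c x)"
  by (simp_all add: free_module_def)

lemma free_moduleD:
  assumes "c \<in> carrier (free_module R X)"
  shows "c x \<in> carrier R" "finite {x. c x \<noteq> \<zero>\<^bsub>R\<^esub>}" "{x. c x \<noteq> \<zero>\<^bsub>R\<^esub>} \<subseteq> X"
  using assms by (auto simp: free_module_def)

lemma single_in_free_module:
  assumes "ring R" "r \<in> carrier R" "x \<in> X"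
  shows "(\<lambda>y. if y = x then r else \<zero>\<^bsub>R\<^esub>) \<in> carrier (free_module R X)"
proof -
  interpret R: ring R by fact
  show ?thesis using assms(2,3)
    by (auto simp: free_module_def intro: finite_subset[of _ "{x}"])
qed

context left_module
begin

text \<open>Supports are not additive: cancellation can shrink the support of a sum. Two coefficient
  functions are compared by summing over a common finite set, the extra terms being zero.\<close>

lemma weighted_sum_superset:
  assumes "c \<in> carrier (free_module R X)" "w \<in> X \<rightarrow> carrier M"
    and "finite S" "{x. c x \<noteq> \<zero>\<^bsub>R\<^esub>} \<subseteq> S" "S \<subseteq> X"
  shows "weighted_sum R M w c = (\<Oplus>\<^bsub>M\<^esub>x\<in>S. c x \<odot>\<^bsub>M\<^esub> w x)"
  unfolding weighted_sum_def
proof (rule M.add.finprod_mono_neutral_cong_left)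
  show "finite S" "{x. c x \<noteq> \<zero>\<^bsub>R\<^esub>} \<subseteq> S" by fact+
  show "(\<lambda>x. c x \<odot>\<^bsub>M\<^esub> w x) \<in> S \<rightarrow> carrier M"
    using assms(2,5) free_moduleD(1)[OF assms(1)] by (auto simp: Pi_iff subset_iff)
  fix i assume "i \<in> S - {x. c x \<noteq> \<zero>\<^bsub>R\<^esub>}"
  then have "c i = \<zero>\<^bsub>R\<^esub>" "w i \<in> carrier M" using assms by auto
  then show "c i \<odot>\<^bsub>M\<^esub> w i = \<zero>\<^bsub>M\<^esub>" by simp
qed simp

lemma weighted_sum_mem_submodule:
  assumes "submodule N R M" "c \<in> carrier (free_module R X)" "w \<in> X \<rightarrow> N"
  shows "weighted_sum R M w c \<in> N"
  unfolding weighted_sum_def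
  using free_moduleD[OF assms(2)] assms(3) submoduleD(5)[OF assms(1)]
  by (intro finsum_mem_submodule[OF assms(1)]) (auto simp: Pi_iff subset_iff)

lemma smult_finsum:
  assumes "finite S" "r \<in> carrier R" "g \<in> S \<rightarrow> carrier M"
  shows "r \<odot>\<^bsub>M\<^esub> finsum M g S = (\<Oplus>\<^bsub>M\<^esub>x\<in>S. r \<odot>\<^bsub>M\<^esub> g x)"
  using assms(1,3)
proof (induction S rule: finite_induct)
  case empty
  then show ?case using assms(2) by simp
next
  case (insert x S)
  then have "g \<in> S \<rightarrow> carrier M" "g x \<in> carrier M" "(\<lambda>x. r \<odot>\<^bsub>M\<^esub> g x) \<in> S \<rightarrow> carrier M"
    using assms(2) by auto
  then show ?case using insert assms(2) by (simp add: smult_r_distr)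
qed

lemma weighted_sum_linear_on:
  assumes w: "w \<in> X \<rightarrow> carrier M"
  shows "linear_on R (free_module R X) (carrier (free_module R X)) M (weighted_sum R M w)"
proof (rule linear_onI)
  interpret F: left_module R "free_module R X"
    by (rule left_module_free) (rule R.ring_axioms)
  show "weighted_sum R M w c \<in> carrier M" if "c \<in> carrier (free_module R X)" for c
    using weighted_sum_mem_submodule[OF submodule_carrier that w] .
  fix c assume c: "c \<in> carrier (free_module R X)"
  let ?C = "{x. c x \<noteq> \<zero>\<^bsub>R\<^esub>}"
  have cw: "(\<lambda>x. c x \<odot>\<^bsub>M\<^esub> w x) \<in> S \<rightarrow> carrier M" if "S \<subseteq> X" "c \<in> carrier (free_module R X)" for c S
    using free_moduleD(1)[OF that(2)] that(1) w by auto
  show "weighted_sum R M w (c \<oplus>\<^bsub>free_module R X\<^esub> d) = weighted_sum R M w c \<oplus>\<^bsub>M\<^esub> weighted_sum R M w d"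
    if d: "d \<in> carrier (free_module R X)" for d
  proof -
    define S where "S = ?C \<union> {x. d x \<noteq> \<zero>\<^bsub>R\<^esub>}"
    have S: "finite S" "?C \<subseteq> S" "{x. d x \<noteq> \<zero>\<^bsub>R\<^esub>} \<subseteq> S" "S \<subseteq> X"
      using free_moduleD[OF c] free_moduleD[OF d] by (auto simp: S_def)
    have cd: "c \<oplus>\<^bsub>free_module R X\<^esub> d \<in> carrier (free_module R X)" using c d by (rule F.M.add.m_closed)
    have "{x. (c \<oplus>\<^bsub>free_module R X\<^esub> d) x \<noteq> \<zero>\<^bsub>R\<^esub>} \<subseteq> S" by (auto simp: S_def)
    then have "weighted_sum R M w (c \<oplus>\<^bsub>free_module R X\<^esub> d) =
        (\<Oplus>\<^bsub>M\<^esub>x\<in>S. (c x \<oplus>\<^bsub>R\<^esub> d x) \<odot>\<^bsub>M\<^esub> w x)"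
      using weighted_sum_superset[OF cd w S(1) _ S(4)] by simp
    also have "\<dots> = (\<Oplus>\<^bsub>M\<^esub>x\<in>S. c x \<odot>\<^bsub>M\<^esub> w x \<oplus>\<^bsub>M\<^esub> d x \<odot>\<^bsub>M\<^esub> w x)"
      using free_moduleD(1)[OF c] free_moduleD(1)[OF d] w S(4)
      by (intro M.finsum_cong') (auto simp: smult_l_distr Pi_iff)
    also have "\<dots> = (\<Oplus>\<^bsub>M\<^esub>x\<in>S. c x \<odot>\<^bsub>M\<^esub> w x) \<oplus>\<^bsub>M\<^esub> (\<Oplus>\<^bsub>M\<^esub>x\<in>S. d x \<odot>\<^bsub>M\<^esub> w x)"
      using cw[OF S(4) c] cw[OF S(4) d] by (rule M.finsum_addf)
    finally show ?thesis
      using weighted_sum_superset[OF c w S(1,2,4)] weighted_sum_superset[OF d w S(1,3,4)] by simp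
  qed
  show "weighted_sum R M w (r \<odot>\<^bsub>free_module R X\<^esub> c) = r \<odot>\<^bsub>M\<^esub> weighted_sum R M w c"
    if r: "r \<in> carrier R" for r
  proof -
    have C: "finite ?C" "?C \<subseteq> X" using free_moduleD[OF c] by auto
    have rc: "r \<odot>\<^bsub>free_module R X\<^esub> c \<in> carrier (free_module R X)" using r c by (rule F.smult_closed)
    have "{x. (r \<odot>\<^bsub>free_module R X\<^esub> c) x \<noteq> \<zero>\<^bsub>R\<^esub>} \<subseteq> ?C" using r by auto
    then have "weighted_sum R M w (r \<odot>\<^bsub>free_module R X\<^esub> c) = (\<Oplus>\<^bsub>M\<^esub>x\<in>?C. (r \<otimes>\<^bsub>R\<^esub> c x) \<odot>\<^bsub>M\<^esub> w x)"
      using weighted_sum_superset[OF rc w C(1) _ C(2)] by simp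
    also have "\<dots> = (\<Oplus>\<^bsub>M\<^esub>x\<in>?C. r \<odot>\<^bsub>M\<^esub> (c x \<odot>\<^bsub>M\<^esub> w x))"
      using free_moduleD(1)[OF c] w C(2) r
      by (intro M.finsum_cong') (auto simp: smult_assoc subset_iff Pi_iff)
    also have "\<dots> = r \<odot>\<^bsub>M\<^esub> weighted_sum R M w c"
      unfolding weighted_sum_def using smult_finsum[OF C(1) r cw[OF C(2) c]] by simp
    finally show ?thesis .
  qed
qed

lemma weighted_sum_single:
  assumes "r \<in> carrier R" "x \<in> X" "w \<in> X \<rightarrow> carrier M"
  shows "weighted_sum R M w (\<lambda>y. if y = x then r else \<zero>\<^bsub>R\<^esub>) = r \<odot>\<^bsub>M\<^esub> w x"
proof -
  have wx: "w x \<in> carrier M" using assms by auto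
  have "weighted_sum R M w (\<lambda>y. if y = x then r else \<zero>\<^bsub>R\<^esub>) =
      (\<Oplus>\<^bsub>M\<^esub>y\<in>{x}. (if y = x then r else \<zero>\<^bsub>R\<^esub>) \<odot>\<^bsub>M\<^esub> w y)"
    using assms(2)
    by (intro weighted_sum_superset[OF single_in_free_module[OF R.ring_axioms assms(1,2)] assms(3)]) auto
  also have "\<dots> = r \<odot>\<^bsub>M\<^esub> w x"
    using M.finsum_insert[of "{}" x "\<lambda>y. (if y = x then r else \<zero>\<^bsub>R\<^esub>) \<odot>\<^bsub>M\<^esub> w y"] assms(1) wx
    by (simp add: Pi_iff)
  finally show ?thesis .
qed

end

lemma weighted_sum_cong:
  assumes "left_module R M" "c \<in> carrier (free_module R X)"
    and "\<And>x. x \<in> X \<Longrightarrow> w x = w' x" "w' \<in> X \<rightarrow> carrier M"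
  shows "weighted_sum R M w c = weighted_sum R M w' c"
proof -
  interpret M: left_module R M by fact
  show ?thesis
    unfolding weighted_sum_def
    using assms(3,4) free_moduleD[OF assms(2)]
    by (intro M.M.finsum_cong') (auto simp: Pi_iff subset_iff)
qed

lemma linear_on_weighted_sum:
  fixes c :: "'x \<Rightarrow> 'r"
  assumes "left_module R A" "left_module R B" "linear_on R A (carrier A) B f"
    and "c \<in> carrier (free_module R X)" "w \<in> X \<rightarrow> carrier A"
  shows "f (weighted_sum R A w c) = weighted_sum R B (\<lambda>x. f (w x)) c"
proof -
  interpret A: left_module R A by fact
  interpret B: left_module R B by fact
  have "f (finsum A g S) = (\<Oplus>\<^bsub>B\<^esub>x\<in>S. f (g x))" if "finite S" "g \<in> S \<rightarrow> carrier A" for g and S :: "'x set"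
    using that
  proof (induction S rule: finite_induct)
    case empty
    then show ?case using linear_on_zero[OF assms(1,2) A.submodule_carrier assms(3)] by simp
  next
    case (insert x S)
    then have "g \<in> S \<rightarrow> carrier A" "g x \<in> carrier A" "(\<lambda>x. f (g x)) \<in> S \<rightarrow> carrier B" "f (g x) \<in> carrier B"
      using linear_onD(1)[OF assms(3)] by auto
    then show ?case using insert linear_onD(2)[OF assms(3)] by simp
  qed
  moreover have "(\<lambda>x. c x \<odot>\<^bsub>A\<^esub> w x) \<in> {x. c x \<noteq> \<zero>\<^bsub>R\<^esub>} \<rightarrow> carrier A"
    using free_moduleD[OF assms(4)] assms(5) by (auto intro!: A.smult_closed)
  ultimately have "f (weighted_sum R A w c) = (\<Oplus>\<^bsub>B\<^esub>x\<in>{x. c x \<noteq> \<zero>\<^bsub>R\<^esub>}. f (c x \<odot>\<^bsub>A\<^esub> w x))"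
    unfolding weighted_sum_def using free_moduleD(2)[OF assms(4)] by simp
  also have "\<dots> = weighted_sum R B (\<lambda>x. f (w x)) c"
    unfolding weighted_sum_def
  proof (rule B.M.finsum_cong')
    fix x assume "x \<in> {x. c x \<noteq> \<zero>\<^bsub>R\<^esub>}"
    then have "w x \<in> carrier A" "c x \<in> carrier R"
      using free_moduleD[OF assms(4)] assms(5) by auto
    then show "f (c x \<odot>\<^bsub>A\<^esub> w x) = c x \<odot>\<^bsub>B\<^esub> f (w x)"
      using linear_onD(3)[OF assms(3)] by simp
  next
    show "(\<lambda>x. c x \<odot>\<^bsub>B\<^esub> f (w x)) \<in> {x. c x \<noteq> \<zero>\<^bsub>R\<^esub>} \<rightarrow> carrier B"
      using free_moduleD[OF assms(4)] assms(5) linear_onD(1)[OF assms(3)]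
      by (auto intro!: B.smult_closed)
  qed simp
  finally show ?thesis .
qed

section \<open>Local rings with radical square zero\<close>

text \<open>An intersection of left ideals. Viewing it as a submodule of the regular module makes
  the lemmas on preimages and on extension from a line applicable to it.\<close>

lemma jacobson_radical_left_ideal:
  assumes "ring R"
  shows "submodule (jacobson_radical R) R (regular_module R)"
proof -
  interpret R: ring R by fact
  interpret left_module R "regular_module R" by (rule left_module_regular) fact
  have I: "\<zero>\<^bsub>R\<^esub> \<in> I" "\<And>x y. x \<in> I \<Longrightarrow> y \<in> I \<Longrightarrow> x \<oplus>\<^bsub>R\<^esub> y \<in> I"
    "\<And>r x. r \<in> carrier R \<Longrightarrow> x \<in> I \<Longrightarrow> r \<otimes>\<^bsub>R\<^esub> x \<in> I"
    if "maximal_left_ideal I R" for I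
  proof -
    have l: "left_ideal I R" using that by (simp add: maximal_left_ideal_def)
    then interpret additive_subgroup I R by (simp add: left_ideal_def)
    show "\<zero>\<^bsub>R\<^esub> \<in> I" "\<And>x y. x \<in> I \<Longrightarrow> y \<in> I \<Longrightarrow> x \<oplus>\<^bsub>R\<^esub> y \<in> I"
      "\<And>r x. r \<in> carrier R \<Longrightarrow> x \<in> I \<Longrightarrow> r \<otimes>\<^bsub>R\<^esub> x \<in> I"
      using l by (auto simp: left_ideal_def)
  qed
  show ?thesis
    by (rule submoduleI) (auto simp: regular_module_def jacobson_radical_def intro: I)
qed

text \<open>An inverse \<open>b\<close> of \<open>a\<close> modulo the radical gives
  \<open>a b = 1 + k\<close> and \<open>b a = 1 + l\<close> with \<open>k\<close>, \<open>l\<close>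
  in the radical. These squares vanish, so \<open>1 - k\<close> and \<open>1 - l\<close> invert the
  right-hand sides, and \<open>a\<close> has a right and a left inverse, which agree.\<close>

lemma unit_if_not_in_radical:
  assumes loc: "local_ring R"
    and sq: "\<And>x y. x \<in> jacobson_radical R \<Longrightarrow> y \<in> jacobson_radical R \<Longrightarrow> x \<otimes>\<^bsub>R\<^esub> y = \<zero>\<^bsub>R\<^esub>"
    and a: "a \<in> carrier R" "a \<notin> jacobson_radical R"
  shows "a \<in> Units R"
proof -
  interpret R: ring R using loc by (simp add: local_ring_def)
  interpret left_module R "regular_module R" by (rule left_module_regular) (rule R.ring_axioms)
  let ?J = "jacobson_radical R"
  have J: "?J \<subseteq> carrier R" "\<zero>\<^bsub>R\<^esub> \<in> ?J" "\<And>x. x \<in> ?J \<Longrightarrow> \<ominus>\<^bsub>R\<^esub> x \<in> ?J"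
    using submoduleD[OF jacobson_radical_left_ideal[OF R.ring_axioms]]
      submoduleD(5)[OF jacobson_radical_left_ideal[OF R.ring_axioms], of "\<ominus>\<^bsub>R\<^esub> \<one>\<^bsub>R\<^esub>"]
    by (auto simp: regular_module_def R.l_minus subset_iff)
  have coset: "x \<in> ?J +>\<^bsub>R\<^esub> x" if "x \<in> carrier R" for x
    using that J(2) by (force simp: a_r_coset_def')
  have "?J +>\<^bsub>R\<^esub> a \<noteq> ?J" using coset[OF a(1)] a(2) by auto
  moreover have "?J +>\<^bsub>R\<^esub> a \<in> carrier (R Quot ?J)"
    using a(1) by (auto simp: FactRing_def A_RCOSETS_def')
  ultimately have "?J +>\<^bsub>R\<^esub> a \<in> Units (R Quot ?J)"
    using loc by (auto simp: local_ring_def division_ring_def FactRing_def)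
  then obtain B where B: "B \<in> a_rcosets\<^bsub>R\<^esub> ?J"
      "rcoset_mult R ?J B (?J +>\<^bsub>R\<^esub> a) = ?J +>\<^bsub>R\<^esub> \<one>\<^bsub>R\<^esub>"
      "rcoset_mult R ?J (?J +>\<^bsub>R\<^esub> a) B = ?J +>\<^bsub>R\<^esub> \<one>\<^bsub>R\<^esub>"
    by (auto simp: Units_def FactRing_def)
  then obtain b where b: "b \<in> carrier R" "B = ?J +>\<^bsub>R\<^esub> b"
    by (auto simp: A_RCOSETS_def')
  \<comment> \<open>\<open>rcoset_mult\<close> is the union of the cosets of all products of
    representatives, so the representatives \<open>a\<close> and \<open>b\<close> may be chosen
    directly.\<close>
  have "a \<otimes>\<^bsub>R\<^esub> b \<in> ?J +>\<^bsub>R\<^esub> \<one>\<^bsub>R\<^esub>"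
    using B(3) b coset[OF a(1)] coset[OF b(1)] coset[of "a \<otimes>\<^bsub>R\<^esub> b"] a(1)
    unfolding rcoset_mult_def by blast
  then obtain k where k: "k \<in> ?J" "a \<otimes>\<^bsub>R\<^esub> b = k \<oplus>\<^bsub>R\<^esub> \<one>\<^bsub>R\<^esub>" by (auto simp: a_r_coset_def')
  have "b \<otimes>\<^bsub>R\<^esub> a \<in> ?J +>\<^bsub>R\<^esub> \<one>\<^bsub>R\<^esub>"
    using B(2) b coset[OF a(1)] coset[OF b(1)] coset[of "b \<otimes>\<^bsub>R\<^esub> a"] a(1)
    unfolding rcoset_mult_def by blast
  then obtain l where l: "l \<in> ?J" "b \<otimes>\<^bsub>R\<^esub> a = l \<oplus>\<^bsub>R\<^esub> \<one>\<^bsub>R\<^esub>" by (auto simp: a_r_coset_def')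
  have unip: "(x \<oplus>\<^bsub>R\<^esub> \<one>\<^bsub>R\<^esub>) \<otimes>\<^bsub>R\<^esub> (\<one>\<^bsub>R\<^esub> \<ominus>\<^bsub>R\<^esub> x) = \<one>\<^bsub>R\<^esub>"
    "(\<one>\<^bsub>R\<^esub> \<ominus>\<^bsub>R\<^esub> x) \<otimes>\<^bsub>R\<^esub> (x \<oplus>\<^bsub>R\<^esub> \<one>\<^bsub>R\<^esub>) = \<one>\<^bsub>R\<^esub>" if "x \<in> ?J" for x
  proof -
    have x: "x \<in> carrier R" "x \<otimes>\<^bsub>R\<^esub> x = \<zero>\<^bsub>R\<^esub>" using that J(1) sq by auto
    have "(x \<oplus>\<^bsub>R\<^esub> \<one>\<^bsub>R\<^esub>) \<otimes>\<^bsub>R\<^esub> (\<one>\<^bsub>R\<^esub> \<ominus>\<^bsub>R\<^esub> x) = \<one>\<^bsub>R\<^esub> \<ominus>\<^bsub>R\<^esub> x \<otimes>\<^bsub>R\<^esub> x" using x(1) by algebra (simp add: R.r_neg1)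
    moreover have "(\<one>\<^bsub>R\<^esub> \<ominus>\<^bsub>R\<^esub> x) \<otimes>\<^bsub>R\<^esub> (x \<oplus>\<^bsub>R\<^esub> \<one>\<^bsub>R\<^esub>) = \<one>\<^bsub>R\<^esub> \<ominus>\<^bsub>R\<^esub> x \<otimes>\<^bsub>R\<^esub> x" using x(1) by algebra (simp add: R.r_neg2)
    ultimately show "(x \<oplus>\<^bsub>R\<^esub> \<one>\<^bsub>R\<^esub>) \<otimes>\<^bsub>R\<^esub> (\<one>\<^bsub>R\<^esub> \<ominus>\<^bsub>R\<^esub> x) = \<one>\<^bsub>R\<^esub>"
      "(\<one>\<^bsub>R\<^esub> \<ominus>\<^bsub>R\<^esub> x) \<otimes>\<^bsub>R\<^esub> (x \<oplus>\<^bsub>R\<^esub> \<one>\<^bsub>R\<^esub>) = \<one>\<^bsub>R\<^esub>"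
      using x by (simp_all add: R.minus_eq)
  qed
  have c: "k \<in> carrier R" "l \<in> carrier R" using k l J(1) by auto
  let ?r = "b \<otimes>\<^bsub>R\<^esub> (\<one>\<^bsub>R\<^esub> \<ominus>\<^bsub>R\<^esub> k)" and ?l = "(\<one>\<^bsub>R\<^esub> \<ominus>\<^bsub>R\<^esub> l) \<otimes>\<^bsub>R\<^esub> b"
  have inv: "a \<otimes>\<^bsub>R\<^esub> ?r = \<one>\<^bsub>R\<^esub>" "?l \<otimes>\<^bsub>R\<^esub> a = \<one>\<^bsub>R\<^esub>" "?r \<in> carrier R" "?l \<in> carrier R"
    using unip(1)[OF k(1)] unip(2)[OF l(1)] a(1) b(1) c k(2) l(2)
    by (auto simp: R.m_assoc[symmetric] ) (simp add: R.m_assoc)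
  then have "?l = ?r" using a(1) R.inv_unique' by (metis R.l_one R.m_assoc R.r_one)
  then show ?thesis using inv a(1) by (auto simp: Units_def)
qed

text \<open>A maximal submodule of \<open>V\<close> avoiding \<open>v\<close> is a complement of the line through \<open>v\<close>.\<close>

lemma linear_extension_from_line:
  assumes R: "local_ring R"
    and sq: "\<And>x y. x \<in> jacobson_radical R \<Longrightarrow> y \<in> jacobson_radical R \<Longrightarrow> x \<otimes>\<^bsub>R\<^esub> y = \<zero>\<^bsub>R\<^esub>"
    and A: "left_module R A" and B: "left_module R B"
    and V: "submodule V R A" "\<And>j y. j \<in> jacobson_radical R \<Longrightarrow> y \<in> V \<Longrightarrow> j \<odot>\<^bsub>A\<^esub> y = \<zero>\<^bsub>A\<^esub>"
    and v: "v \<in> V" "v \<noteq> \<zero>\<^bsub>A\<^esub>"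
    and x: "x \<in> carrier B" "\<And>j. j \<in> jacobson_radical R \<Longrightarrow> j \<odot>\<^bsub>B\<^esub> x = \<zero>\<^bsub>B\<^esub>"
  obtains f where "linear_on R A V B f" "f v = x" "\<And>y. y \<in> V \<Longrightarrow> \<exists>r\<in>carrier R. f y = r \<odot>\<^bsub>B\<^esub> x"
proof -
  interpret A: left_module R A by fact
  interpret B: left_module R B by fact
  let ?J = "jacobson_radical R"
  note VD = A.submoduleD[OF V(1)]
  have vA: "v \<in> carrier A" using VD v by auto
  define \<N> where "\<N> = {N. submodule N R A \<and> N \<subseteq> V \<and> v \<notin> N}"
  have "\<exists>N\<in>\<N>. \<forall>X\<in>\<N>. N \<subseteq> X \<longrightarrow> X = N"
  proof (rule subset_Zorn_nonempty)
    show "\<N> \<noteq> {}" using A.submodule_zero v VD(2) by (auto simp: \<N>_def)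
    fix C assume C: "C \<noteq> {}" "subset.chain \<N> C"
    have sub: "submodule N R A" "N \<subseteq> V" "v \<notin> N" if "N \<in> C" for N
      using C(2) that by (auto simp: \<N>_def subset.chain_def)
    have "submodule (\<Union>C) R A"
    proof (rule A.submoduleI)
      show "\<Union>C \<subseteq> carrier A" "\<zero>\<^bsub>A\<^esub> \<in> \<Union>C" using sub A.submoduleD C(1) by blast+
      show "a \<odot>\<^bsub>A\<^esub> y \<in> \<Union>C" if "a \<in> carrier R" "y \<in> \<Union>C" for a y
        using that sub(1) A.submoduleD(5) by blast
      fix y z assume "y \<in> \<Union>C" "z \<in> \<Union>C"
      then obtain N L where NL: "y \<in> N" "N \<in> C" "z \<in> L" "L \<in> C" by auto
      then have "N \<subseteq> L \<or> L \<subseteq> N" using C(2) by (auto simp: subset_chain_def)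
      then show "y \<oplus>\<^bsub>A\<^esub> z \<in> \<Union>C" using NL sub(1) A.submoduleD(3) by blast
    qed
    then show "\<Union>C \<in> \<N>" using sub by (auto simp: \<N>_def)
  qed
  then obtain N where N: "submodule N R A" "N \<subseteq> V" "v \<notin> N"
    and max: "\<And>X. submodule X R A \<Longrightarrow> X \<subseteq> V \<Longrightarrow> v \<notin> X \<Longrightarrow> N \<subseteq> X \<Longrightarrow> X = N"
    by (auto simp: \<N>_def)
  note ND = A.submoduleD[OF N(1)]
  have NA: "n \<in> carrier A" if "n \<in> N" for n using that ND by auto
  \<comment> \<open>The line through \<open>v\<close> meets \<open>N\<close> only in multiples by
    the radical: a unit \<open>r\<close> would bring \<open>v\<close> itself into
    \<open>N\<close>.\<close>
  have rad: "r \<in> ?J" if r: "r \<in> carrier R" "r \<odot>\<^bsub>A\<^esub> v \<in> N" for r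
  proof (rule ccontr)
    assume "r \<notin> ?J"
    then have u: "r \<in> Units R" using unit_if_not_in_radical[OF R sq] r by blast
    then have "inv\<^bsub>R\<^esub> r \<odot>\<^bsub>A\<^esub> (r \<odot>\<^bsub>A\<^esub> v) = v"
      using vA r(1) by (simp flip: A.smult_assoc)
    then show False using ND(5)[of "inv\<^bsub>R\<^esub> r" "r \<odot>\<^bsub>A\<^esub> v"] r(2) u N(3) by simp
  qed
  \<comment> \<open>\<open>V = N + R v\<close>. For \<open>w\<close> outside \<open>N\<close>,
    maximality puts \<open>v\<close> into \<open>N + R w\<close>, say \<open>v = n + r w\<close>.
    Here \<open>r\<close> is a unit, since a radical element kills \<open>w\<close> and would leave
    \<open>v = n\<close> in \<open>N\<close>; so the equation can be solved for
    \<open>w\<close>.\<close>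
  have decomp: "\<exists>r\<in>carrier R. \<exists>n\<in>N. w = n \<oplus>\<^bsub>A\<^esub> r \<odot>\<^bsub>A\<^esub> v" if w: "w \<in> V" for w
  proof (cases "w \<in> N")
    case True
    then have "w = w \<oplus>\<^bsub>A\<^esub> \<zero>\<^bsub>R\<^esub> \<odot>\<^bsub>A\<^esub> v" using NA vA by simp
    then show ?thesis using True by blast
  next
    case False
    have wA: "w \<in> carrier A" using w VD by auto
    let ?X = "{n \<oplus>\<^bsub>A\<^esub> r \<odot>\<^bsub>A\<^esub> w | n r. n \<in> N \<and> r \<in> carrier R}"
    have X: "submodule ?X R A"
    proof (rule A.submoduleI)
      show "?X \<subseteq> carrier A" using NA wA by auto
      have "\<zero>\<^bsub>A\<^esub> = \<zero>\<^bsub>A\<^esub> \<oplus>\<^bsub>A\<^esub> \<zero>\<^bsub>R\<^esub> \<odot>\<^bsub>A\<^esub> w" using wA by simp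
      then show "\<zero>\<^bsub>A\<^esub> \<in> ?X" using ND(2) by blast
    next
      fix y z assume "y \<in> ?X" "z \<in> ?X"
      then obtain n r m s where yz: "y = n \<oplus>\<^bsub>A\<^esub> r \<odot>\<^bsub>A\<^esub> w" "z = m \<oplus>\<^bsub>A\<^esub> s \<odot>\<^bsub>A\<^esub> w"
        "n \<in> N" "m \<in> N" "r \<in> carrier R" "s \<in> carrier R" by auto
      then have "y \<oplus>\<^bsub>A\<^esub> z = (n \<oplus>\<^bsub>A\<^esub> m) \<oplus>\<^bsub>A\<^esub> (r \<oplus>\<^bsub>R\<^esub> s) \<odot>\<^bsub>A\<^esub> w"
        using NA wA by (simp add: A.smult_l_distr A.M.add.m_ac)
      then show "y \<oplus>\<^bsub>A\<^esub> z \<in> ?X" using yz ND(3) by blast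
    next
      fix a y assume "a \<in> carrier R" "y \<in> ?X"
      then obtain n r where y: "y = n \<oplus>\<^bsub>A\<^esub> r \<odot>\<^bsub>A\<^esub> w" "n \<in> N" "r \<in> carrier R" by auto
      then have "a \<odot>\<^bsub>A\<^esub> y = a \<odot>\<^bsub>A\<^esub> n \<oplus>\<^bsub>A\<^esub> (a \<otimes>\<^bsub>R\<^esub> r) \<odot>\<^bsub>A\<^esub> w"
        using NA wA \<open>a \<in> carrier R\<close> by (simp add: A.smult_r_distr A.smult_assoc)
      then show "a \<odot>\<^bsub>A\<^esub> y \<in> ?X" using y ND(5) \<open>a \<in> carrier R\<close> by blast
    qed
    have "N \<subseteq> ?X"
    proof
      fix n assume "n \<in> N"
      then have "n = n \<oplus>\<^bsub>A\<^esub> \<zero>\<^bsub>R\<^esub> \<odot>\<^bsub>A\<^esub> w" using NA wA by simp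
      then show "n \<in> ?X" using \<open>n \<in> N\<close> by blast
    qed
    moreover have "?X \<subseteq> V" using N(2) w VD by blast
    moreover have "w \<in> ?X"
    proof -
      have "w = \<zero>\<^bsub>A\<^esub> \<oplus>\<^bsub>A\<^esub> \<one>\<^bsub>R\<^esub> \<odot>\<^bsub>A\<^esub> w" using wA by simp
      then show ?thesis using ND(2) by blast
    qed
    ultimately have "v \<in> ?X" using max[OF X] False by blast
    then obtain n r where nr: "n \<in> N" "r \<in> carrier R" "v = n \<oplus>\<^bsub>A\<^esub> r \<odot>\<^bsub>A\<^esub> w" by auto
    have "r \<notin> ?J"
    proof
      assume "r \<in> ?J"
      then have "v = n" using nr V(2)[OF _ w] NA by simp
      then show False using nr N(3) by simp
    qed
    then have u: "r \<in> Units R" using unit_if_not_in_radical[OF R sq] nr by blast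
    let ?s = "inv\<^bsub>R\<^esub> r"
    have "?s \<odot>\<^bsub>A\<^esub> v = ?s \<odot>\<^bsub>A\<^esub> n \<oplus>\<^bsub>A\<^esub> w"
      using nr u NA wA by (simp add: A.smult_r_distr flip: A.smult_assoc)
    then have "w = \<ominus>\<^bsub>A\<^esub> (?s \<odot>\<^bsub>A\<^esub> n) \<oplus>\<^bsub>A\<^esub> ?s \<odot>\<^bsub>A\<^esub> v"
      using u nr NA wA vA by (simp add: A.M.r_neg2 A.M.r_neg1)
    moreover have "\<ominus>\<^bsub>A\<^esub> (?s \<odot>\<^bsub>A\<^esub> n) \<in> N" using u nr ND by simp
    ultimately show ?thesis using u by blast
  qed
  \<comment> \<open>\<open>P w r\<close> says that \<open>r\<close> is a possible coefficient of
    \<open>v\<close> in \<open>w\<close>. It is not unique, but two choices differ by an element of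
    the radical, which kills \<open>x\<close>; this is what \<open>wd\<close> shows.\<close>
  define P where "P w r \<longleftrightarrow> r \<in> carrier R \<and> (\<exists>n\<in>N. w = n \<oplus>\<^bsub>A\<^esub> r \<odot>\<^bsub>A\<^esub> v)" for w r
  define f where "f w = (SOME r. P w r) \<odot>\<^bsub>B\<^esub> x" for w
  have wd: "r \<odot>\<^bsub>B\<^esub> x = s \<odot>\<^bsub>B\<^esub> x" if P: "P w r" "P w s" for w r s
  proof -
    obtain n m where nm: "n \<in> N" "m \<in> N" "w = n \<oplus>\<^bsub>A\<^esub> r \<odot>\<^bsub>A\<^esub> v" "w = m \<oplus>\<^bsub>A\<^esub> s \<odot>\<^bsub>A\<^esub> v"
      and rs: "r \<in> carrier R" "s \<in> carrier R"
      using P unfolding P_def by blast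
    have "r \<odot>\<^bsub>A\<^esub> v = \<ominus>\<^bsub>A\<^esub> n \<oplus>\<^bsub>A\<^esub> (m \<oplus>\<^bsub>A\<^esub> s \<odot>\<^bsub>A\<^esub> v)"
      using nm rs NA vA by (metis A.M.r_neg1 A.smult_closed)
    then have "(r \<ominus>\<^bsub>R\<^esub> s) \<odot>\<^bsub>A\<^esub> v = \<ominus>\<^bsub>A\<^esub> n \<oplus>\<^bsub>A\<^esub> m"
      using rs nm NA vA
      by (simp add: A.R.minus_eq A.smult_l_distr A.smult_minus_left A.M.add.m_assoc A.M.r_neg)
    also have "\<dots> \<in> N" using nm ND by simp
    finally have "(r \<ominus>\<^bsub>R\<^esub> s) \<odot>\<^bsub>B\<^esub> x = \<zero>\<^bsub>B\<^esub>" using rad[of "r \<ominus>\<^bsub>R\<^esub> s"] x(2) rs by simp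
    then have "r \<odot>\<^bsub>B\<^esub> x \<oplus>\<^bsub>B\<^esub> \<ominus>\<^bsub>B\<^esub> (s \<odot>\<^bsub>B\<^esub> x) = \<zero>\<^bsub>B\<^esub>"
      using rs x(1) by (simp add: A.R.minus_eq B.smult_l_distr B.smult_minus_left)
    then show ?thesis
      using rs x(1) B.M.minus_equality[of "r \<odot>\<^bsub>B\<^esub> x" "\<ominus>\<^bsub>B\<^esub> (s \<odot>\<^bsub>B\<^esub> x)"] by simp
  qed
  have fP: "f w = r \<odot>\<^bsub>B\<^esub> x" if "P w r" for w r
    unfolding f_def by (rule wd[OF someI[of "P w"]]) (rule that)+
  have ex: "\<exists>r. P w r" if "w \<in> V" for w using decomp[OF that] by (auto simp: P_def)
  show thesis
  proof
    show "linear_on R A V B f"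
    proof (rule linear_onI)
      fix w assume "w \<in> V"
      then obtain r where r: "P w r" using ex by blast
      then show "f w \<in> carrier B" using fP[OF r] x(1) by (simp add: P_def)
      show "f (a \<odot>\<^bsub>A\<^esub> w) = a \<odot>\<^bsub>B\<^esub> f w" if a: "a \<in> carrier R" for a
      proof -
        obtain n where n: "n \<in> N" "w = n \<oplus>\<^bsub>A\<^esub> r \<odot>\<^bsub>A\<^esub> v" "r \<in> carrier R"
          using r by (auto simp: P_def)
        then have "a \<odot>\<^bsub>A\<^esub> w = a \<odot>\<^bsub>A\<^esub> n \<oplus>\<^bsub>A\<^esub> (a \<otimes>\<^bsub>R\<^esub> r) \<odot>\<^bsub>A\<^esub> v"
          using NA vA a by (simp add: A.smult_r_distr A.smult_assoc)
        then have "P (a \<odot>\<^bsub>A\<^esub> w) (a \<otimes>\<^bsub>R\<^esub> r)" using n a ND(5) by (auto simp: P_def)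
        then show ?thesis using fP[OF r] fP a n x(1) by (simp add: B.smult_assoc)
      qed
      show "f (w \<oplus>\<^bsub>A\<^esub> z) = f w \<oplus>\<^bsub>B\<^esub> f z" if z: "z \<in> V" for z
      proof -
        obtain s where s: "P z s" using ex[OF z] by blast
        obtain n m where n: "n \<in> N" "w = n \<oplus>\<^bsub>A\<^esub> r \<odot>\<^bsub>A\<^esub> v" "r \<in> carrier R"
          and m: "m \<in> N" "z = m \<oplus>\<^bsub>A\<^esub> s \<odot>\<^bsub>A\<^esub> v" "s \<in> carrier R"
          using r s by (auto simp: P_def)
        then have "w \<oplus>\<^bsub>A\<^esub> z = (n \<oplus>\<^bsub>A\<^esub> m) \<oplus>\<^bsub>A\<^esub> (r \<oplus>\<^bsub>R\<^esub> s) \<odot>\<^bsub>A\<^esub> v"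
          using NA vA by (simp add: A.smult_l_distr A.M.add.m_ac)
        then have "P (w \<oplus>\<^bsub>A\<^esub> z) (r \<oplus>\<^bsub>R\<^esub> s)" using n m ND(3) by (auto simp: P_def)
        then show ?thesis using fP[OF r] fP[OF s] fP n m x(1) by (simp add: B.smult_l_distr)
      qed
    qed
    have "P v \<one>\<^bsub>R\<^esub>" using ND(2) vA by (auto simp: P_def intro!: bexI[of _ "\<zero>\<^bsub>A\<^esub>"])
    then show "f v = x" using fP x(1) by simp
    show "\<exists>r\<in>carrier R. f y = r \<odot>\<^bsub>B\<^esub> x" if "y \<in> V" for y
      using ex[OF that] fP by (auto simp: P_def)
  qed
qed

section \<open>Vanishing of the first extension group\<close>

text \<open>Composing \<open>\<phi>\<close> with \<open>res_d1\<close> gives a cocycle, which is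
  then a coboundary, coming from some \<open>h\<close> on \<open>res_P0\<close>. Since
  \<open>res_P1\<close> has a basis vector for every single relation, agreement after
  \<open>res_d1\<close> already means agreement on all relations.\<close>

lemma Ext1_trivial_imp_extension:
  fixes M :: "('r, 'm) module" and N :: "('r, 'n) module"
  assumes M: "left_module R M" and N: "left_module R N" and Ext: "trivial_group (Ext1 R M N)"
    and \<phi>: "linear_on R (res_P0 R M)
      {p \<in> carrier (res_P0 R M). linear_combination R M p = \<zero>\<^bsub>M\<^esub>} N \<phi>"
  obtains h where "linear_on R (res_P0 R M) (carrier (res_P0 R M)) N h"
    "\<And>p. p \<in> carrier (res_P0 R M) \<Longrightarrow> linear_combination R M p = \<zero>\<^bsub>M\<^esub> \<Longrightarrow> h p = \<phi> p"
proof -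
  interpret M: left_module R M by fact
  interpret N: left_module R N by fact
  note R = M.R.ring_axioms
  let ?P0 = "res_P0 R M" and ?P1 = "res_P1 R M" and ?P2 = "res_P2 R M"
  let ?d1 = "res_d1 R M" and ?d2 = "res_d2 R M"
  let ?K0 = "{p \<in> carrier ?P0. linear_combination R M p = \<zero>\<^bsub>M\<^esub>}"
  let ?K1 = "{p \<in> carrier ?P1. ?d1 p = \<zero>\<^bsub>?P0\<^esub>}"
  interpret P0: left_module R ?P0 unfolding res_P0_def by (rule left_module_free) (rule R)
  interpret P1: left_module R ?P1 unfolding res_P1_def by (rule left_module_free) (rule R)
  interpret P2: left_module R ?P2 unfolding res_P2_def by (rule left_module_free) (rule R)
  have d0: "linear_on R ?P0 (carrier ?P0) M (linear_combination R M)"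
    unfolding linear_combination_eq_weighted_sum res_P0_def
    by (rule M.weighted_sum_linear_on) simp
  have K0: "submodule ?K0 R ?P0"
    using submodule_vimage[OF P0.left_module_axioms M P0.submodule_carrier d0 M.submodule_zero]
    by simp
  have d1: "linear_on R ?P1 (carrier ?P1) ?P0 ?d1"
    unfolding res_d1_def linear_combination_eq_weighted_sum res_P1_def
    by (rule P0.weighted_sum_linear_on) auto
  have d1_K0: "?d1 p \<in> ?K0" if "p \<in> carrier ?P1" for p
    using that unfolding res_d1_def linear_combination_eq_weighted_sum[of R ?P0] res_P1_def
    by (intro P0.weighted_sum_mem_submodule[OF K0]) auto
  have K1: "submodule ?K1 R ?P1"
    using submodule_vimage[OF P1.left_module_axioms P0.left_module_axioms P1.submodule_carrier d1
      P0.submodule_zero] by simp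
  have d2_K1: "?d2 p \<in> ?K1" if "p \<in> carrier ?P2" for p
    using that unfolding res_d2_def linear_combination_eq_weighted_sum[of R ?P1] res_P2_def
    by (intro P1.weighted_sum_mem_submodule[OF K1]) auto
  define g where "g = precomp ?P1 ?d1 \<phi>"
  have "linear_on R ?P1 (carrier ?P1) N (\<lambda>x. \<phi> (?d1 x))"
    by (rule linear_on_comp[OF d1 \<phi> d1_K0])
  then have g: "g \<in> module_hom R ?P1 N"
    unfolding g_def precomp_def by (rule restrict_linear_on[OF P1.left_module_axioms])
  have \<phi>0: "\<phi> \<zero>\<^bsub>?P0\<^esub> = \<zero>\<^bsub>N\<^esub>"
    by (rule linear_on_zero[OF P0.left_module_axioms N K0 \<phi>])
  let ?G = "(hom_group R ?P1 N)\<lparr>carrier := kernel (hom_group R ?P1 N) (hom_group R ?P2 N)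
                    (precomp ?P2 ?d2)\<rparr>"
  let ?H = "precomp ?P1 ?d1 ` carrier (hom_group R ?P0 N)"
  have "precomp ?P2 ?d2 g = (\<lambda>x\<in>carrier ?P2. \<zero>\<^bsub>N\<^esub>)"
    unfolding precomp_def
  proof (rule restrict_ext)
    fix x assume "x \<in> carrier ?P2"
    then show "g (?d2 x) = \<zero>\<^bsub>N\<^esub>" using d2_K1[of x] \<phi>0 by (simp add: g_def precomp_def)
  qed
  then have "g \<in> carrier ?G"
    using g by (simp add: kernel_def hom_group_def)
  then have "?H #>\<^bsub>?G\<^esub> g \<in> carrier (Ext1 R M N)"
    unfolding Ext1_def FactGroup_def RCOSETS_def by auto
  moreover have "\<one>\<^bsub>Ext1 R M N\<^esub> = ?H" by (simp add: Ext1_def FactGroup_def)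
  ultimately have "?H #>\<^bsub>?G\<^esub> g = ?H" using Ext by (simp add: trivial_group_def)
  \<comment> \<open>The zero homomorphism contributes \<open>g\<close> to its own coset. Outside
    \<open>carrier ?P1\<close> both sides are \<open>undefined\<close>, as \<open>g\<close> is
    extensional.\<close>
  moreover have "g \<in> ?H #>\<^bsub>?G\<^esub> g"
  proof -
    have "linear_on R ?P0 (carrier ?P0) N (\<lambda>x. \<zero>\<^bsub>N\<^esub>)" by (rule linear_onI) auto
    then have z: "(\<lambda>x\<in>carrier ?P0. \<zero>\<^bsub>N\<^esub>) \<in> carrier (hom_group R ?P0 N)"
      using restrict_linear_on[OF P0.left_module_axioms] by (simp add: hom_group_def)
    have gE: "g \<in> carrier ?P1 \<rightarrow>\<^sub>E carrier N" using g by (simp add: module_hom_def)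
    have "precomp ?P1 ?d1 (\<lambda>x\<in>carrier ?P0. \<zero>\<^bsub>N\<^esub>) \<otimes>\<^bsub>?G\<^esub> g = g"
    proof
      fix x
      show "(precomp ?P1 ?d1 (\<lambda>x\<in>carrier ?P0. \<zero>\<^bsub>N\<^esub>) \<otimes>\<^bsub>?G\<^esub> g) x = g x"
        using linear_onD(1)[OF d1, of x] PiE_arb[OF gE] PiE_mem[OF gE]
        by (cases "x \<in> carrier ?P1") (auto simp: hom_group_def precomp_def)
    qed
    then show ?thesis using z by (force simp: r_coset_def)
  qed
  ultimately have "g \<in> ?H" by simp
  then obtain h where h: "h \<in> module_hom R ?P0 N" "g = precomp ?P1 ?d1 h"
    by (auto simp: hom_group_def)
  show thesis
  proof
    show "linear_on R ?P0 (carrier ?P0) N h" using h(1) by (rule module_hom_imp_linear_on)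
    fix p assume p: "p \<in> carrier ?P0" "linear_combination R M p = \<zero>\<^bsub>M\<^esub>"
    \<comment> \<open>The basis vector of \<open>?P1\<close> belonging to the relation
      \<open>p\<close>; \<open>?d1\<close> maps it back to \<open>p\<close>.\<close>
    let ?e = "\<lambda>y. if y = p then \<one>\<^bsub>R\<^esub> else \<zero>\<^bsub>R\<^esub>"
    have e: "?e \<in> carrier ?P1"
      unfolding res_P1_def by (rule single_in_free_module[OF R]) (use p in auto)
    have "?d1 ?e = \<one>\<^bsub>R\<^esub> \<odot>\<^bsub>?P0\<^esub> p"
      unfolding res_d1_def linear_combination_eq_weighted_sum
      by (rule P0.weighted_sum_single[where X = ?K0]) (use p in auto)
    then have "?d1 ?e = p" using p by simp
    moreover have "h (?d1 ?e) = g ?e" using e by (simp add: h(2) precomp_def)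
    moreover have "\<phi> (?d1 ?e) = g ?e" using e by (simp add: g_def precomp_def)
    ultimately show "h p = \<phi> p" by simp
  qed
qed

section \<open>Splitting off free summands\<close>

text \<open>For \<open>q\<close> the identity this is the lifting property of a projective module;
  for \<open>q\<close> a linear projection it says that the image of \<open>q\<close> is projective,
  expressed without making the image a module.\<close>

definition lifts_along_surjections ::
    "'a itself \<Rightarrow> 'b itself \<Rightarrow> ('r, 'e) ring_scheme \<Rightarrow> ('r, 'm) module \<Rightarrow> ('m \<Rightarrow> 'm) \<Rightarrow> bool" where
  "lifts_along_surjections TA TB R M q \<longleftrightarrow>
    (\<forall>(A :: ('r, 'a) module) (B :: ('r, 'b) module) g f.
       left_module R A \<longrightarrow> left_module R B \<longrightarrow> linear_on R A (carrier A) B g \<longrightarrow>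
       g ` carrier A = carrier B \<longrightarrow> linear_on R M (carrier M) B f \<longrightarrow>
       (\<exists>h. linear_on R M (carrier M) A h \<and> (\<forall>x \<in> carrier M. g (h x) = f (q x))))"

lemma lifts_along_surjections_cong:
  assumes "lifts_along_surjections TA TB R M q" "\<And>x. x \<in> carrier M \<Longrightarrow> q x = q' x"
  shows "lifts_along_surjections TA TB R M q'"
  using assms unfolding lifts_along_surjections_def by simp

text \<open>The starting point of the splitting, where \<open>p\<close> is the identity and its
  complement is zero.\<close>

lemma lifts_along_surjections_zero:
  fixes M :: "('r, 'm) module" and TA :: "'a itself" and TB :: "'b itself"
  assumes M: "left_module R M"
  shows "lifts_along_surjections TA TB R M (\<lambda>x. \<zero>\<^bsub>M\<^esub>)"
  unfolding lifts_along_surjections_def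
proof (intro allI impI)
  fix A :: "('r, 'a) module" and B :: "('r, 'b) module" and g f
  assume A: "left_module R A" and B: "left_module R B" and g: "linear_on R A (carrier A) B g"
    and f: "linear_on R M (carrier M) B f"
  interpret M: left_module R M by fact
  interpret A: left_module R A by fact
  have "linear_on R M (carrier M) A (\<lambda>x. \<zero>\<^bsub>A\<^esub>)" by (rule linear_onI) auto
  moreover have "g \<zero>\<^bsub>A\<^esub> = f \<zero>\<^bsub>M\<^esub>"
    using linear_on_zero[OF A B A.submodule_carrier g] linear_on_zero[OF M B M.submodule_carrier f]
    by simp
  ultimately show "\<exists>h. linear_on R M (carrier M) A h \<and> (\<forall>x \<in> carrier M. g (h x) = f \<zero>\<^bsub>M\<^esub>)"
    by blast
qed

text \<open>The added map factors through the regular module via \<open>l\<close>, and a map out of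
  the regular module lifts as soon as the image of 1 does: a preimage \<open>a\<close> of
  \<open>f z\<close> turns a lift \<open>h\<close> into \<open>h x + l x a\<close>.\<close>

lemma lifts_along_surjections_add_rank_one:
  fixes M :: "('r, 'm) module" and TA :: "'a itself" and TB :: "'b itself"
  assumes M: "left_module R M" and q: "lifts_along_surjections TA TB R M q"
    and qM: "\<And>x. x \<in> carrier M \<Longrightarrow> q x \<in> carrier M"
    and l: "linear_on R M (carrier M) (regular_module R) l" and z: "z \<in> carrier M"
  shows "lifts_along_surjections TA TB R M (\<lambda>x. q x \<oplus>\<^bsub>M\<^esub> l x \<odot>\<^bsub>M\<^esub> z)"
  unfolding lifts_along_surjections_def
proof (intro allI impI)
  fix A :: "('r, 'a) module" and B :: "('r, 'b) module" and g f
  assume A: "left_module R A" and B: "left_module R B" and g: "linear_on R A (carrier A) B g"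
    and surj: "g ` carrier A = carrier B" and f: "linear_on R M (carrier M) B f"
  interpret M: left_module R M by fact
  interpret A: left_module R A by fact
  interpret B: left_module R B by fact
  obtain h where h: "linear_on R M (carrier M) A h" "\<And>x. x \<in> carrier M \<Longrightarrow> g (h x) = f (q x)"
    using q A B g surj f unfolding lifts_along_surjections_def by blast
  have "f z \<in> carrier B" using linear_onD(1)[OF f] z by blast
  then obtain a where a: "a \<in> carrier A" "g a = f z" using surj by (metis imageE)
  have lR: "l x \<in> carrier R" if "x \<in> carrier M" for x
    using linear_onD(1)[OF l that] by (simp add: regular_module_def)
  have ladd: "l (x \<oplus>\<^bsub>M\<^esub> y) = l x \<oplus>\<^bsub>R\<^esub> l y" if "x \<in> carrier M" "y \<in> carrier M" for x y
    using linear_onD(2)[OF l that] by (simp add: regular_module_def)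
  have lsm: "l (r \<odot>\<^bsub>M\<^esub> x) = r \<otimes>\<^bsub>R\<^esub> l x" if "r \<in> carrier R" "x \<in> carrier M" for r x
    using linear_onD(3)[OF l that] by (simp add: regular_module_def)
  have "linear_on R M (carrier M) A (\<lambda>x. h x \<oplus>\<^bsub>A\<^esub> l x \<odot>\<^bsub>A\<^esub> a)"
    by (rule linear_onI)
      (simp_all add: linear_onD[OF h(1)] lR ladd lsm a A.smult_l_distr A.smult_r_distr A.smult_assoc
        A.M.add.m_ac)
  moreover have "g (h x \<oplus>\<^bsub>A\<^esub> l x \<odot>\<^bsub>A\<^esub> a) = f (q x \<oplus>\<^bsub>M\<^esub> l x \<odot>\<^bsub>M\<^esub> z)" if "x \<in> carrier M" for x
    using that by (simp add: linear_onD[OF g] linear_onD[OF f] linear_onD[OF h(1)] lR a h(2) qM z)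
  ultimately show "\<exists>h. linear_on R M (carrier M) A h \<and>
      (\<forall>x \<in> carrier M. g (h x) = f (q x \<oplus>\<^bsub>M\<^esub> l x \<odot>\<^bsub>M\<^esub> z))"
    by blast
qed

text \<open>If all functionals vanish at \<open>x\<close>, the evaluation map does not distinguish
  \<open>x\<close> from zero, and it is injective.\<close>

lemma torsionless_separates:
  assumes M: "left_module R M" and tl: "torsionless R M" and x: "x \<in> carrier M"
    and zero: "\<And>l. linear_on R M (carrier M) (regular_module R) l \<Longrightarrow> l x = \<zero>\<^bsub>R\<^esub>"
  shows "x = \<zero>\<^bsub>M\<^esub>"
proof -
  interpret M: left_module R M by fact
  have reg: "left_module R (regular_module R)" by (rule left_module_regular) (rule M.R.ring_axioms)
  have "l x = l \<zero>\<^bsub>M\<^esub>" if "l \<in> module_hom R M (regular_module R)" for l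
    using zero[OF module_hom_imp_linear_on[OF that]]
      linear_on_zero[OF M reg M.submodule_carrier module_hom_imp_linear_on[OF that]]
    by (simp add: regular_module_def)
  then have "evaluation_map R M x = evaluation_map R M \<zero>\<^bsub>M\<^esub>"
    using x by (auto simp: evaluation_map_def dual_module_def intro!: restrict_ext)
  then show ?thesis using tl x by (auto simp: torsionless_def dest: inj_onD)
qed

text \<open>
  Whenever a functional takes a value outside the radical on the summand \<open>p M\<close>, that value is a unit
  and a copy of the regular module splits off from \<open>p M\<close>, which lowers the number of generators.
\<close>

lemma splitting_off_free_summands:
  fixes M :: "('r, 'm) module" and TA :: "'a itself" and TB :: "'b itself"
  assumes loc: "local_ring R"
    and sq: "\<And>x y. x \<in> jacobson_radical R \<Longrightarrow> y \<in> jacobson_radical R \<Longrightarrow> x \<otimes>\<^bsub>R\<^esub> y = \<zero>\<^bsub>R\<^esub>"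
    and M: "left_module R M"
    and "finite Z" "linear_on R M (carrier M) M p" "\<And>x. x \<in> carrier M \<Longrightarrow> p (p x) = p x"
    and "Z \<subseteq> p ` carrier M"
    and "\<And>N. submodule N R M \<Longrightarrow> Z \<subseteq> N \<Longrightarrow> p ` carrier M \<subseteq> N"
    and "lifts_along_surjections TA TB R M (\<lambda>x. x \<ominus>\<^bsub>M\<^esub> p x)"
  shows "\<exists>p. linear_on R M (carrier M) M p \<and> (\<forall>x \<in> carrier M. p (p x) = p x) \<and>
    lifts_along_surjections TA TB R M (\<lambda>x. x \<ominus>\<^bsub>M\<^esub> p x) \<and>
    (\<forall>l x. linear_on R M (carrier M) (regular_module R) l \<longrightarrow> x \<in> carrier M \<longrightarrow>
      l (p x) \<in> jacobson_radical R)"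
  using assms(4-)
proof (induction "card Z" arbitrary: Z p rule: less_induct)
  case less
  interpret M: left_module R M by fact
  let ?J = "jacobson_radical R"
  have reg: "left_module R (regular_module R)" by (rule left_module_regular) (rule M.R.ring_axioms)
  note p = linear_onD[OF less.prems(2)]
  note idem = less.prems(3)
  show ?case
  proof (cases "\<forall>l x. linear_on R M (carrier M) (regular_module R) l \<longrightarrow> x \<in> carrier M \<longrightarrow> l (p x) \<in> ?J")
    case True
    then show ?thesis using less.prems by blast
  next
    case False
    then obtain l x where l: "linear_on R M (carrier M) (regular_module R) l"
      and x: "x \<in> carrier M" "l (p x) \<notin> ?J" by blast
    have lR: "l y \<in> carrier R" if "y \<in> carrier M" for y
      using linear_onD(1)[OF l that] by (simp add: regular_module_def)
    have ladd: "l (y \<oplus>\<^bsub>M\<^esub> z) = l y \<oplus>\<^bsub>R\<^esub> l z" if "y \<in> carrier M" "z \<in> carrier M" for y z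
      using linear_onD(2)[OF l that] by (simp add: regular_module_def)
    have lsm: "l (r \<odot>\<^bsub>M\<^esub> y) = r \<otimes>\<^bsub>R\<^esub> l y" if "r \<in> carrier R" "y \<in> carrier M" for r y
      using linear_onD(3)[OF l that] by (simp add: regular_module_def)
    \<comment> \<open>If every generator had its value in the radical, so would all of
      \<open>p M\<close>, including \<open>p x\<close>. Hence the unit value can be found at an
      element \<open>z\<close> of \<open>Z\<close> itself, which is what lets the cardinality
      drop.\<close>
    have "submodule {y \<in> carrier M. l y \<in> ?J} R M"
      by (rule submodule_vimage[OF M reg M.submodule_carrier l
            jacobson_radical_left_ideal[OF M.R.ring_axioms]])
    then have "\<not> Z \<subseteq> {y \<in> carrier M. l y \<in> ?J}" using less.prems(5) x by blast
    then obtain z where z: "z \<in> Z" "l z \<notin> ?J" using less.prems(4) p(1) by blast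
    have zM: "z \<in> carrier M" "p z = z" using z less.prems(4) p(1) idem by auto
    define u where "u = inv\<^bsub>R\<^esub> (l z)"
    have "l z \<in> Units R" using unit_if_not_in_radical[OF loc sq lR[OF zM(1)] z(2)] by blast
    then have u: "u \<in> carrier R" "l z \<otimes>\<^bsub>R\<^esub> u = \<one>\<^bsub>R\<^esub>" by (simp_all add: u_def)
    \<comment> \<open>\<open>l\<close> composed with \<open>p\<close> and normalised so that
      \<open>k z = 1\<close>; the factor \<open>u\<close> stands on the right to keep
      \<open>k\<close> left linear. Then \<open>k y z\<close> is the component of \<open>y\<close>
      along the free summand \<open>R z\<close>, and \<open>p'\<close> removes it from
      \<open>p\<close>.\<close>
    define k where "k y = l (p y) \<otimes>\<^bsub>R\<^esub> u" for y
    define p' where "p' y = p y \<ominus>\<^bsub>M\<^esub> k y \<odot>\<^bsub>M\<^esub> z" for y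
    have kR: "k y \<in> carrier R" if "y \<in> carrier M" for y
      using that by (simp add: k_def lR p(1) u)
    have kadd: "k (y \<oplus>\<^bsub>M\<^esub> w) = k y \<oplus>\<^bsub>R\<^esub> k w" if "y \<in> carrier M" "w \<in> carrier M" for y w
      using that by (simp add: k_def p ladd lR u M.R.l_distr)
    have ksm: "k (r \<odot>\<^bsub>M\<^esub> y) = r \<otimes>\<^bsub>R\<^esub> k y" if "r \<in> carrier R" "y \<in> carrier M" for r y
      using that by (simp add: k_def p lsm lR u M.R.m_assoc)
    have k: "linear_on R M (carrier M) (regular_module R) k"
      by (rule linear_onI) (simp_all add: regular_module_def kR kadd ksm)
    have p': "linear_on R M (carrier M) M p'"
      by (rule linear_onI)
        (simp_all add: p'_def M.M.minus_eq p kR kadd ksm zM M.smult_l_distr M.smult_r_distr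
          M.smult_assoc M.smult_minus_right M.M.minus_add M.M.add.m_ac)
    note p'D = linear_onD[OF p']
    have p'z: "p' z = \<zero>\<^bsub>M\<^esub>"
      using zM by (simp add: p'_def k_def u M.M.minus_eq M.M.r_neg)
    have kp: "k (p y) = k y" if "y \<in> carrier M" for y using that by (simp add: k_def idem)
    have p'p: "p' (p y) = p' y" if "y \<in> carrier M" for y
      using that by (simp add: p'_def kp idem)
    have idem': "p' (p' y) = p' y" if y: "y \<in> carrier M" for y
    proof -
      \<comment> \<open>Writing the subtracted term as a multiple by \<open>-k y\<close> makes
        linearity of \<open>p'\<close> applicable; the term then dies because \<open>p' z\<close> is
        zero.\<close>
      have "p' (p' y) = p' (p y \<oplus>\<^bsub>M\<^esub> (\<ominus>\<^bsub>R\<^esub> k y) \<odot>\<^bsub>M\<^esub> z)"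
        unfolding p'_def[of y] using y zM kR by (simp add: M.M.minus_eq M.smult_minus_left)
      also have "\<dots> = p' y" using y zM kR p by (simp add: p'D p'p p'z)
      finally show ?thesis .
    qed
    have lift': "lifts_along_surjections TA TB R M (\<lambda>y. y \<ominus>\<^bsub>M\<^esub> p' y)"
    proof (rule lifts_along_surjections_cong)
      show "lifts_along_surjections TA TB R M (\<lambda>y. (y \<ominus>\<^bsub>M\<^esub> p y) \<oplus>\<^bsub>M\<^esub> k y \<odot>\<^bsub>M\<^esub> z)"
        using p by (intro lifts_along_surjections_add_rank_one[OF M less.prems(6) _ k zM(1)]) simp
      show "y \<ominus>\<^bsub>M\<^esub> p y \<oplus>\<^bsub>M\<^esub> k y \<odot>\<^bsub>M\<^esub> z = y \<ominus>\<^bsub>M\<^esub> p' y" if "y \<in> carrier M" for y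
        using that by (simp add: p'_def M.M.minus_eq M.M.minus_add p kR zM M.M.add.m_assoc)
    qed
    let ?Z = "p' ` (Z - {z})"
    have "card ?Z \<le> card (Z - {z})" using less.prems(1) by (intro card_image_le) simp
    also have "\<dots> < card Z" using less.prems(1) z(1) by (rule card_Diff1_less)
    finally have card: "card ?Z < card Z" .
    have ZM: "Z \<subseteq> carrier M" using less.prems(4) p(1) by auto
    have gen': "p' ` carrier M \<subseteq> N" if N: "submodule N R M" "?Z \<subseteq> N" for N
    proof -
      \<comment> \<open>The preimage of \<open>N\<close> under \<open>p'\<close> contains
        \<open>Z\<close>, with \<open>z\<close> going to zero, hence contains \<open>p M\<close>;
        and \<open>p' p = p'\<close> turns this into a statement about \<open>p' M\<close>.\<close>
      have "submodule {y \<in> carrier M. p' y \<in> N} R M"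
        by (rule submodule_vimage[OF M M M.submodule_carrier p' N(1)])
      moreover have "p' y \<in> N" if "y \<in> Z" for y
        using that N(2) p'z M.submoduleD(2)[OF N(1)] by (cases "y = z") auto
      then have "Z \<subseteq> {y \<in> carrier M. p' y \<in> N}" using ZM by auto
      ultimately have "p ` carrier M \<subseteq> {y \<in> carrier M. p' y \<in> N}" by (rule less.prems(5))
      then show ?thesis using p'p by force
    qed
    show ?thesis
      by (rule less.hyps[OF card _ p' idem' _ gen' lift']) (use less.prems(1) ZM in auto)
  qed
qed

section \<open>Semisimple summands\<close>

text \<open>
  If \<open>m = p m\<close> is non-zero and \<open>j\<close> is a non-zero element of the radical, the projection onto the
  simple module \<open>R m\<close> lifts to a functional on \<open>P\<^sub>0\<close> that maps relations to the radical. Composed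
  with a map from the radical to \<open>R m\<close> sending \<open>j\<close> to \<open>m\<close>, it extends to \<open>P\<^sub>0\<close> only if \<open>m\<close> lies in
  \<open>j M\<close>, and \<open>p\<close> kills \<open>j M\<close>.
\<close>

lemma no_semisimple_summand:
  assumes loc: "local_ring R"
    and sq: "\<And>x y. x \<in> jacobson_radical R \<Longrightarrow> y \<in> jacobson_radical R \<Longrightarrow> x \<otimes>\<^bsub>R\<^esub> y = \<zero>\<^bsub>R\<^esub>"
    and M: "left_module R M" and Ext: "trivial_group (Ext1 R M M)"
    and p: "linear_on R M (carrier M) M p" "\<And>x. x \<in> carrier M \<Longrightarrow> p (p x) = p x"
    and Jp: "\<And>r x. r \<in> jacobson_radical R \<Longrightarrow> x \<in> carrier M \<Longrightarrow> r \<odot>\<^bsub>M\<^esub> p x = \<zero>\<^bsub>M\<^esub>"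
    and j: "j \<in> jacobson_radical R" "j \<noteq> \<zero>\<^bsub>R\<^esub>"
    and y: "y \<in> carrier M"
  shows "p y = \<zero>\<^bsub>M\<^esub>"
proof (rule ccontr)
  assume nz: "p y \<noteq> \<zero>\<^bsub>M\<^esub>"
  interpret M: left_module R M by fact
  note R = M.R.ring_axioms
  let ?J = "jacobson_radical R" and ?Reg = "regular_module R" and ?P0 = "res_P0 R M"
  interpret Reg: left_module R ?Reg by (rule left_module_regular) (rule R)
  interpret P0: left_module R ?P0 unfolding res_P0_def by (rule left_module_free) (rule R)
  note J = jacobson_radical_left_ideal[OF R]
  note pD = linear_onD[OF p(1)]
  define m where "m = p y"
  have m: "m \<in> carrier M" "p m = m" "m \<noteq> \<zero>\<^bsub>M\<^esub>"
    using nz y pD(1) p(2) by (auto simp: m_def)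
  have jR: "j \<in> carrier R" using j(1) Reg.submoduleD(1)[OF J] by (auto simp: regular_module_def)
  have Jm: "r \<odot>\<^bsub>M\<^esub> m = \<zero>\<^bsub>M\<^esub>" if "r \<in> ?J" for r using Jp[OF that y] by (simp add: m_def)
  \<comment> \<open>The image of the idempotent \<open>p\<close>, described by its fixed
    points.\<close>
  let ?V = "{x \<in> carrier M. p x = x}"
  have V: "submodule ?V R M"
    by (rule M.submoduleI)
      (auto simp: pD linear_on_zero[OF M M M.submodule_carrier p(1)])
  have JV: "r \<odot>\<^bsub>M\<^esub> x = \<zero>\<^bsub>M\<^esub>" if "r \<in> ?J" "x \<in> ?V" for r x
    using Jp[OF that(1), of x] that(2) by simp
  have mV: "m \<in> ?V" using m by simp
  \<comment> \<open>Extending the identity of the line \<open>R m\<close> yields a projection of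
    \<open>p M\<close> onto that line.\<close>
  obtain \<theta> where \<theta>: "linear_on R M ?V M \<theta>" "\<theta> m = m"
    "\<And>x. x \<in> ?V \<Longrightarrow> \<exists>r\<in>carrier R. \<theta> x = r \<odot>\<^bsub>M\<^esub> m"
    using linear_extension_from_line[OF loc sq M M V JV mV m(3) m(1) Jm] by blast
  define q where "q x = \<theta> (p x)" for x
  have q: "linear_on R M (carrier M) M q"
    unfolding q_def by (rule linear_on_comp[OF p(1) \<theta>(1)]) (simp add: pD p(2))
  \<comment> \<open>A coefficient of \<open>q x\<close> along \<open>m\<close> is chosen for each
    \<open>x\<close>, not linearly. Fixing the value 1 at \<open>m\<close> makes \<open>L\<close>
    take exactly the value \<open>j\<close> at \<open>j\<close> times the basis vector of
    \<open>m\<close>.\<close>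
  have "\<exists>r. x \<in> carrier M \<longrightarrow> r \<in> carrier R \<and> q x = r \<odot>\<^bsub>M\<^esub> m \<and> (x = m \<longrightarrow> r = \<one>\<^bsub>R\<^esub>)" for x
  proof (cases "x = m")
    case True
    then show ?thesis using m \<theta>(2) by (auto simp: q_def)
  next
    case False
    then show ?thesis using \<theta>(3)[of "p x"] pD(1) p(2) by (auto simp: q_def)
  qed
  then obtain c where c: "\<And>x. x \<in> carrier M \<Longrightarrow> c x \<in> carrier R"
    "\<And>x. x \<in> carrier M \<Longrightarrow> q x = c x \<odot>\<^bsub>M\<^esub> m" "c m = \<one>\<^bsub>R\<^esub>"
    using m(1) by metis
  have cPi: "c \<in> carrier M \<rightarrow> carrier ?Reg" using c(1) by (simp add: regular_module_def)
  define L where "L = weighted_sum R ?Reg c"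
  have L: "linear_on R ?P0 (carrier ?P0) ?Reg L"
    unfolding L_def res_P0_def by (rule Reg.weighted_sum_linear_on[OF cPi])
  have Lm: "L d \<odot>\<^bsub>M\<^esub> m = q (linear_combination R M d)" if "d \<in> carrier ?P0" for d
  proof -
    have d: "d \<in> carrier (free_module R (carrier M))" using that by (simp add: res_P0_def)
    have "linear_on R ?Reg (carrier ?Reg) M (\<lambda>r. r \<odot>\<^bsub>M\<^esub> m)"
      by (rule linear_onI)
        (simp_all add: regular_module_def m M.smult_l_distr M.smult_assoc)
    then have "L d \<odot>\<^bsub>M\<^esub> m = weighted_sum R M (\<lambda>x. c x \<odot>\<^bsub>M\<^esub> m) d"
      unfolding L_def by (rule linear_on_weighted_sum[OF Reg.left_module_axioms M _ d cPi])
    also have "\<dots> = weighted_sum R M (\<lambda>x. q x) d"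
      by (rule weighted_sum_cong[OF M d]) (use c linear_onD(1)[OF q] in auto)
    also have "\<dots> = q (linear_combination R M d)"
      unfolding linear_combination_eq_weighted_sum
      by (rule linear_on_weighted_sum[OF M M q d, symmetric]) simp
    finally show ?thesis .
  qed
  let ?K = "{d \<in> carrier ?P0. linear_combination R M d = \<zero>\<^bsub>M\<^esub>}"
  \<comment> \<open>On a relation \<open>L d\<close> kills \<open>m\<close>, which no unit can do
    since \<open>m\<close> is nonzero. So \<open>L\<close> sends relations into the domain of
    \<open>\<eta>\<close>.\<close>
  have LJ: "L d \<in> ?J" if d: "d \<in> ?K" for d
  proof (rule ccontr)
    assume notin: "L d \<notin> ?J"
    have LR: "L d \<in> carrier R" using linear_onD(1)[OF L] d by (simp add: regular_module_def)
    have u: "L d \<in> Units R" using unit_if_not_in_radical[OF loc sq LR notin] by blast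
    have "L d \<odot>\<^bsub>M\<^esub> m = \<zero>\<^bsub>M\<^esub>"
      using Lm d linear_on_zero[OF M M M.submodule_carrier q] by simp
    then have "inv\<^bsub>R\<^esub> L d \<odot>\<^bsub>M\<^esub> (L d \<odot>\<^bsub>M\<^esub> m) = \<zero>\<^bsub>M\<^esub>" using u by simp
    then show False using u LR m by (simp flip: M.smult_assoc)
  qed
  have JJ: "r \<odot>\<^bsub>?Reg\<^esub> x = \<zero>\<^bsub>?Reg\<^esub>" if "r \<in> ?J" "x \<in> ?J" for r x
    using sq[OF that] by (simp add: regular_module_def)
  have j0: "j \<noteq> \<zero>\<^bsub>?Reg\<^esub>" using j(2) by (simp add: regular_module_def)
  obtain \<eta> where \<eta>: "linear_on R ?Reg ?J M \<eta>" "\<eta> j = m"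
    using linear_extension_from_line[OF loc sq Reg.left_module_axioms M J JJ j(1) j0 m(1) Jm]
    by blast
  have "linear_on R ?P0 ?K M (\<lambda>d. \<eta> (L d))"
    by (rule linear_on_comp[OF linear_on_subset[OF L] \<eta>(1) LJ]) auto
  then obtain h where h: "linear_on R ?P0 (carrier ?P0) M h"
    "\<And>d. d \<in> carrier ?P0 \<Longrightarrow> linear_combination R M d = \<zero>\<^bsub>M\<^esub> \<Longrightarrow> h d = \<eta> (L d)"
    using Ext1_trivial_imp_extension[OF M M Ext] by blast
  let ?e = "\<lambda>r x. if x = m then r else \<zero>\<^bsub>R\<^esub>"
  have e: "?e r \<in> carrier ?P0" if "r \<in> carrier R" for r
    unfolding res_P0_def by (rule single_in_free_module[OF R that m(1)])
  \<comment> \<open>The decisive relation is \<open>j\<close> times the basis vector of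
    \<open>m\<close>, a relation because \<open>j\<close> kills \<open>m\<close>. The cocycle takes
    the value \<open>m\<close> on it.\<close>
  have "linear_combination R M (?e j) = j \<odot>\<^bsub>M\<^esub> m"
    unfolding linear_combination_eq_weighted_sum
    by (rule M.weighted_sum_single[OF jR m(1)]) simp
  then have "h (?e j) = \<eta> (L (?e j))" using h(2)[OF e[OF jR]] Jm[OF j(1)] by simp
  also have "L (?e j) = j"
    unfolding L_def using Reg.weighted_sum_single[OF jR m(1) cPi] jR c(3)
    by (simp add: regular_module_def)
  finally have "h (?e j) = m" using \<eta>(2) by simp
  \<comment> \<open>In \<open>?P0\<close> the relation is divisible by \<open>j\<close>, so the
    extension \<open>h\<close> must send it into \<open>j M\<close>.\<close>
  moreover have "?e j = j \<odot>\<^bsub>?P0\<^esub> ?e \<one>\<^bsub>R\<^esub>" using jR by (auto simp: res_P0_def)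
  ultimately have "m = j \<odot>\<^bsub>M\<^esub> h (?e \<one>\<^bsub>R\<^esub>)" using linear_onD(3)[OF h(1) jR e] by simp
  moreover have "h (?e \<one>\<^bsub>R\<^esub>) \<in> carrier M" using linear_onD(1)[OF h(1) e] by simp
  \<comment> \<open>Linearity moves \<open>j\<close> outside \<open>p\<close>, and \<open>j\<close>
    kills \<open>p M\<close>; but \<open>p\<close> fixes the nonzero \<open>m\<close>.\<close>
  ultimately have "p m = \<zero>\<^bsub>M\<^esub>" using pD(3) Jp j(1) jR by metis
  then show False using m by simp
qed

section \<open>Vanishing of the summand \<open>p M\<close> and projectivity of
  \<open>M\<close>\<close>

theorem theorem3p4:
  fixes \<Lambda> :: "'r ring" and M :: "('r, 'm) module"
  assumes "artin_algebra \<Lambda>"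
    and "local_ring \<Lambda>"
    and "jacobson_radical \<Lambda> \<cdot>\<^bsub>\<Lambda>\<^esub> jacobson_radical \<Lambda> = {\<zero>\<^bsub>\<Lambda>\<^esub>}"
    and "left_module \<Lambda> M"
    and "fin_gen_module \<Lambda> M"
    and "torsionless \<Lambda> M"
    and "trivial_group (Ext1 \<Lambda> M M)"
  shows "projective_module TYPE('a) TYPE('b) \<Lambda> M"
proof -
  note M = assms(4)
  interpret M: left_module \<Lambda> M by fact
  let ?J = "jacobson_radical \<Lambda>"
  have sq: "x \<otimes>\<^bsub>\<Lambda>\<^esub> y = \<zero>\<^bsub>\<Lambda>\<^esub>" if "x \<in> ?J" "y \<in> ?J" for x y
    using ideal_prod.prod[of x ?J y ?J \<Lambda>] that assms(3) by auto
  obtain Z where Z: "finite Z" "Z \<subseteq> carrier M"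
    "\<And>x. x \<in> carrier M \<Longrightarrow> \<exists>c \<in> Z \<rightarrow> carrier \<Lambda>. x = (\<Oplus>\<^bsub>M\<^esub>s\<in>Z. c s \<odot>\<^bsub>M\<^esub> s)"
    using assms(5) unfolding fin_gen_module_def by blast
  \<comment> \<open>Generation is restated through submodules containing \<open>Z\<close>, the form
    in which it is carried through the splitting, here for \<open>p\<close> the identity.\<close>
  have gen: "(\<lambda>x. x) ` carrier M \<subseteq> N" if N: "submodule N \<Lambda> M" "Z \<subseteq> N" for N
  proof
    fix x assume "x \<in> (\<lambda>x. x) ` carrier M"
    then obtain c where c: "c \<in> Z \<rightarrow> carrier \<Lambda>" "x = (\<Oplus>\<^bsub>M\<^esub>s\<in>Z. c s \<odot>\<^bsub>M\<^esub> s)" using Z(3) by auto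
    have "(\<lambda>s. c s \<odot>\<^bsub>M\<^esub> s) \<in> Z \<rightarrow> N" using c(1) N(2) M.submoduleD(5)[OF N(1)] by blast
    then show "x \<in> N" unfolding c(2) by (rule M.finsum_mem_submodule[OF N(1) Z(1)])
  qed
  have id: "linear_on \<Lambda> M (carrier M) M (\<lambda>x. x)" by (rule linear_onI) simp_all
  have "lifts_along_surjections TYPE('a) TYPE('b) \<Lambda> M (\<lambda>x. x \<ominus>\<^bsub>M\<^esub> x)"
    by (rule lifts_along_surjections_cong[OF lifts_along_surjections_zero[OF M]])
      (simp add: M.M.minus_eq M.M.r_neg)
  then have "\<exists>p. linear_on \<Lambda> M (carrier M) M p \<and> (\<forall>x \<in> carrier M. p (p x) = p x) \<and>
    lifts_along_surjections TYPE('a) TYPE('b) \<Lambda> M (\<lambda>x. x \<ominus>\<^bsub>M\<^esub> p x) \<and>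
    (\<forall>l x. linear_on \<Lambda> M (carrier M) (regular_module \<Lambda>) l \<longrightarrow> x \<in> carrier M \<longrightarrow> l (p x) \<in> ?J)"
    using Z(2) by (intro splitting_off_free_summands[OF assms(2) sq M Z(1) id _ _ gen]) auto
  then obtain p where p: "linear_on \<Lambda> M (carrier M) M p" "\<And>x. x \<in> carrier M \<Longrightarrow> p (p x) = p x"
    and lift: "lifts_along_surjections TYPE('a) TYPE('b) \<Lambda> M (\<lambda>x. x \<ominus>\<^bsub>M\<^esub> p x)"
    and pJ: "\<And>l x. linear_on \<Lambda> M (carrier M) (regular_module \<Lambda>) l \<Longrightarrow> x \<in> carrier M \<Longrightarrow> l (p x) \<in> ?J"
    by blast
  note pD = linear_onD[OF p(1)]
  have JR: "?J \<subseteq> carrier \<Lambda>" by (auto simp: jacobson_radical_def)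
  have Jp: "r \<odot>\<^bsub>M\<^esub> p x = \<zero>\<^bsub>M\<^esub>" if r: "r \<in> ?J" and x: "x \<in> carrier M" for r x
  proof (rule torsionless_separates[OF M assms(6)])
    show "r \<odot>\<^bsub>M\<^esub> p x \<in> carrier M" using r x JR pD(1) by auto
    fix l assume l: "linear_on \<Lambda> M (carrier M) (regular_module \<Lambda>) l"
    \<comment> \<open>A functional takes \<open>r (p x)\<close> to \<open>r\<close> times a value in
      the radical, hence to zero by the square-zero condition; as functionals separate points,
      \<open>r\<close> kills \<open>p x\<close>.\<close>
    have "l (r \<odot>\<^bsub>M\<^esub> p x) = r \<otimes>\<^bsub>\<Lambda>\<^esub> l (p x)"
      using linear_onD(3)[OF l, of r "p x"] r x JR pD(1) by (auto simp: regular_module_def)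
    then show "l (r \<odot>\<^bsub>M\<^esub> p x) = \<zero>\<^bsub>\<Lambda>\<^esub>" using sq[OF r pJ[OF l x]] by simp
  qed
  have p0: "p x = \<zero>\<^bsub>M\<^esub>" if x: "x \<in> carrier M" for x
  proof (cases "\<exists>j\<in>?J. j \<noteq> \<zero>\<^bsub>\<Lambda>\<^esub>")
    case True
    then obtain j where "j \<in> ?J" "j \<noteq> \<zero>\<^bsub>\<Lambda>\<^esub>" by blast
    then show ?thesis using no_semisimple_summand[OF assms(2) sq M assms(7) p Jp _ _ x] by blast
  next
    \<comment> \<open>With zero radical, the values of all functionals on \<open>p M\<close> lie in
      the radical and so vanish.\<close>
    case False
    then show ?thesis
      using torsionless_separates[OF M assms(6) pD(1)[OF x]] pJ[OF _ x] by blast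
  qed
  have lift_id: "lifts_along_surjections TYPE('a) TYPE('b) \<Lambda> M (\<lambda>x. x)"
    by (rule lifts_along_surjections_cong[OF lift]) (simp add: p0 M.M.minus_eq)
  show ?thesis
    unfolding projective_module_def
  proof (intro conjI allI ballI impI M)
    fix A :: "('r, 'a) module" and B :: "('r, 'b) module" and g f
    assume AB: "g \<in> module_hom \<Lambda> A B" "left_module \<Lambda> A" "left_module \<Lambda> B"
      "g ` carrier A = carrier B" "f \<in> module_hom \<Lambda> M B"
    have "\<exists>h. linear_on \<Lambda> M (carrier M) A h \<and> (\<forall>x\<in>carrier M. g (h x) = f x)"
      using lift_id[unfolded lifts_along_surjections_def, rule_format, OF AB(2,3)
          module_hom_imp_linear_on[OF AB(1)] AB(4) module_hom_imp_linear_on[OF AB(5)]] .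
    then obtain h where "linear_on \<Lambda> M (carrier M) A h" "\<And>x. x \<in> carrier M \<Longrightarrow> g (h x) = f x"
      by blast
    then show "\<exists>h\<in>module_hom \<Lambda> M A. \<forall>x\<in>carrier M. g (h x) = f x"
      using restrict_linear_on[OF M] by (intro bexI[of _ "restrict h (carrier M)"]) auto
  qed
qed

end
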